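(* Let $G$ be a unique product group and suppose $S$ is a strongly $G$-graded ring with $R=S_e$. Let $M$ be a nonzero right $R$-module. Then the following conditions are equivalent. (1) $M$ is $S$-prime, i.e. the right $S$-module $M\otimes_R S$ is prime. (2) If $m\in M$, $b\in R$, and $m(S_gbS_{g^{-1}})=0$ for all $g\in G$, then $m=0$ or $Mb=0$. (3) If $m\in M$, $B$ is a $G$-invariant ideal of $R$, and $mB=0$, then $m=0$ or $MB=0$. (4) For every nonzero submodule $N$ of $M$, we have $(\operatorname{ann} N:G)=(\operatorname{ann} M:G)$.
   Context: Rings have $1$, modules are unital right modules, ideals are two-sided. A unique product group is a group $G$ (identity $e$) such that whenever $X,Y$ are nonempty finite subsets of $G$, there exist $x\in X$, $y\in Y$ with $xy\ne x'y'$ for every pair $(x',y')\in X\times Y$ different from $(x,y)$. A $G$-graded ring is a ring $S=\bigoplus_{g\in G}S_g$ with $S_gS_h\subseteq S_{gh}$ and $1\in S_e$; it is strongly graded if $S_gS_h=S_{gh}$ for all $g,h\in G$. For an ideal $I$ of $R$ and $g\in G$, $I^g=S_gIS_{g^{-1}}$. $I$ is $G$-invariant if $I^g=I$ for all $g\in G$. $(I:G)=\bigcap_{g\in G}I^g$, the largest $G$-invariant ideal contained in $I$. $\operatorname{ann} N=\{r\in R: Nr=0\}$. A nonzero module $M$ is prime if $\operatorname{ann} N=\operatorname{ann} M$ for all nonzero submodules $N$ of $M$. *)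

theory Defs
  imports "HOL-Algebra.Module" "HOL-Algebra.QuotRing" "HOL-Algebra.Generated_Groups"
    "HOL-Algebra.Free_Abelian_Groups"
begin

definition unique_product_group :: "('g, 'x) monoid_scheme \<Rightarrow> bool" where
  "unique_product_group G \<longleftrightarrow>
     group G \<and>
     (\<forall>X Y. finite X \<and> X \<noteq> {} \<and> X \<subseteq> carrier G \<and> finite Y \<and> Y \<noteq> {} \<and> Y \<subseteq> carrier G \<longrightarrow>
        (\<exists>x\<in>X. \<exists>y\<in>Y. \<forall>x'\<in>X. \<forall>y'\<in>Y. (x', y') \<noteq> (x, y) \<longrightarrow>
           x \<otimes>\<^bsub>G\<^esub> y \<noteq> x' \<otimes>\<^bsub>G\<^esub> y'))"

text \<open>The product of two subsets of a ring, in the ring-theoretic sense: all finite sums of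
  products, i.e. the additive subgroup generated by the elementwise products.\<close>

definition span_mult :: "('s, 'y) ring_scheme \<Rightarrow> 's set \<Rightarrow> 's set \<Rightarrow> 's set" where
  "span_mult S X Y = generate (add_monoid S) (X <#>\<^bsub>S\<^esub> Y)"

text \<open>A grading is a family \<open>A\<close> of additive subgroups, \<open>A g\<close> being the component of degree
  \<open>g\<close>. Internal directness of the sum: summation is an isomorphism from the external direct sum
  \<^const>\<open>sum_group\<close> (families of finite support) onto the additive group of \<open>S\<close>.\<close>

locale graded_ring = G: group G + S: ring S
  for G :: "('g, 'x) monoid_scheme" and S :: "('s, 'y) ring_scheme" and A :: "'g \<Rightarrow> 's set" +
  assumes component_subgroup: "g \<in> carrier G \<Longrightarrow> additive_subgroup (A g) S"
    and direct_sum: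
      "(\<lambda>f. gfinprod (add_monoid S) f (carrier G))
         \<in> iso (sum_group (carrier G) (\<lambda>g. add_monoid (S\<lparr>carrier := A g\<rparr>))) (add_monoid S)"
    and component_mult:
      "g \<in> carrier G \<Longrightarrow> h \<in> carrier G \<Longrightarrow> span_mult S (A g) (A h) \<subseteq> A (g \<otimes>\<^bsub>G\<^esub> h)"
    and one_component: "\<one>\<^bsub>S\<^esub> \<in> A \<one>\<^bsub>G\<^esub>"

locale strongly_graded_ring = graded_ring +
  assumes component_mult_eq:
      "g \<in> carrier G \<Longrightarrow> h \<in> carrier G \<Longrightarrow> span_mult S (A g) (A h) = A (g \<otimes>\<^bsub>G\<^esub> h)"

text \<open>\<open>conj_span G S A g X\<close> is $S_g X S_{g^{-1}}$, which is $I^g$ when \<open>X\<close> is an ideal $I$ of $S_e$.\<close>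

definition conj_span ::
    "('g, 'x) monoid_scheme \<Rightarrow> ('s, 'y) ring_scheme \<Rightarrow> ('g \<Rightarrow> 's set) \<Rightarrow> 'g \<Rightarrow> 's set \<Rightarrow> 's set" where
  "conj_span G S A g X = span_mult S (span_mult S (A g) X) (A (inv\<^bsub>G\<^esub> g))"

definition G_invariant ::
    "('g, 'x) monoid_scheme \<Rightarrow> ('s, 'y) ring_scheme \<Rightarrow> ('g \<Rightarrow> 's set) \<Rightarrow> 's set \<Rightarrow> bool" where
  "G_invariant G S A I \<longleftrightarrow> (\<forall>g\<in>carrier G. conj_span G S A g I = I)"

definition G_core ::
    "('g, 'x) monoid_scheme \<Rightarrow> ('s, 'y) ring_scheme \<Rightarrow> ('g \<Rightarrow> 's set) \<Rightarrow> 's set \<Rightarrow> 's set" where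
  "G_core G S A I = (\<Inter>g\<in>carrier G. conj_span G S A g I)"

text \<open>Right modules over rings that need not be commutative. As for \<^typ>\<open>('a, 'b) module\<close>,
  the record extends \<^typ>\<open>'b ring\<close> only to inherit the additive notation; the fields
  \<^const>\<open>monoid.mult\<close> and \<^const>\<open>monoid.one\<close> carry no information.\<close>

record ('a, 'b) right_module = "'b ring" +
  rsmult :: "'b \<Rightarrow> 'a \<Rightarrow> 'b" (infixl \<open>\<triangleleft>\<index>\<close> 70)

locale right_module = R: ring R + M: abelian_group M
  for R :: "('a, 'y) ring_scheme" and M :: "('a, 'b, 'z) right_module_scheme" +
  assumes rsmult_closed:
      "x \<in> carrier M \<Longrightarrow> r \<in> carrier R \<Longrightarrow> x \<triangleleft>\<^bsub>M\<^esub> r \<in> carrier M"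
    and rsmult_l_distr:
      "x \<in> carrier M \<Longrightarrow> y \<in> carrier M \<Longrightarrow> r \<in> carrier R \<Longrightarrow>
        (x \<oplus>\<^bsub>M\<^esub> y) \<triangleleft>\<^bsub>M\<^esub> r = x \<triangleleft>\<^bsub>M\<^esub> r \<oplus>\<^bsub>M\<^esub> y \<triangleleft>\<^bsub>M\<^esub> r"
    and rsmult_r_distr:
      "x \<in> carrier M \<Longrightarrow> r \<in> carrier R \<Longrightarrow> s \<in> carrier R \<Longrightarrow>
        x \<triangleleft>\<^bsub>M\<^esub> (r \<oplus>\<^bsub>R\<^esub> s) = x \<triangleleft>\<^bsub>M\<^esub> r \<oplus>\<^bsub>M\<^esub> x \<triangleleft>\<^bsub>M\<^esub> s"
    and rsmult_assoc:
      "x \<in> carrier M \<Longrightarrow> r \<in> carrier R \<Longrightarrow> s \<in> carrier R \<Longrightarrow>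
        x \<triangleleft>\<^bsub>M\<^esub> (r \<otimes>\<^bsub>R\<^esub> s) = (x \<triangleleft>\<^bsub>M\<^esub> r) \<triangleleft>\<^bsub>M\<^esub> s"
    and rsmult_one: "x \<in> carrier M \<Longrightarrow> x \<triangleleft>\<^bsub>M\<^esub> \<one>\<^bsub>R\<^esub> = x"

locale right_submodule = subgroup N "add_monoid M"
  for N and R :: "('a, 'y) ring_scheme" and M :: "('a, 'b, 'z) right_module_scheme" +
  assumes rsmult_closed: "x \<in> N \<Longrightarrow> r \<in> carrier R \<Longrightarrow> x \<triangleleft>\<^bsub>M\<^esub> r \<in> N"

definition annihilator ::
    "('a, 'y) ring_scheme \<Rightarrow> ('a, 'b, 'z) right_module_scheme \<Rightarrow> 'b set \<Rightarrow> 'a set" where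
  "annihilator R M N = {r \<in> carrier R. \<forall>n\<in>N. n \<triangleleft>\<^bsub>M\<^esub> r = \<zero>\<^bsub>M\<^esub>}"

definition prime_right_module ::
    "('a, 'y) ring_scheme \<Rightarrow> ('a, 'b, 'z) right_module_scheme \<Rightarrow> bool" where
  "prime_right_module R M \<longleftrightarrow>
     right_module R M \<and> carrier M \<noteq> {\<zero>\<^bsub>M\<^esub>} \<and>
     (\<forall>N. right_submodule N R M \<and> N \<noteq> {\<zero>\<^bsub>M\<^esub>} \<longrightarrow>
        annihilator R M N = annihilator R M (carrier M))"

text \<open>The tensor product \<open>M \<otimes>\<^sub>R S\<close> of a right \<open>R\<close>-module with an overring \<open>S\<close> of \<open>R\<close>, as a right
  \<open>S\<close>-module: the free abelian group on \<open>carrier M \<times> carrier S\<close> modulo the subgroup generated by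
  the biadditivity and \<open>R\<close>-balancedness relations, with \<open>S\<close> acting on the second factor.\<close>

definition tensor_free ::
    "('s, 'y) ring_scheme \<Rightarrow> ('s, 'm, 'z) right_module_scheme \<Rightarrow> ('m \<times> 's \<Rightarrow>\<^sub>0 int) monoid" where
  "tensor_free S M = free_Abelian_group (carrier M \<times> carrier S)"

definition tensor_relators ::
    "('s, 'x) ring_scheme \<Rightarrow> ('s, 'y) ring_scheme \<Rightarrow> ('s, 'm, 'z) right_module_scheme \<Rightarrow>
     ('m \<times> 's \<Rightarrow>\<^sub>0 int) set" where
  "tensor_relators R S M =
     {frag_of (x \<oplus>\<^bsub>M\<^esub> y, s) - frag_of (x, s) - frag_of (y, s) | x y s.
        x \<in> carrier M \<and> y \<in> carrier M \<and> s \<in> carrier S} \<union>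
     {frag_of (x, s \<oplus>\<^bsub>S\<^esub> t) - frag_of (x, s) - frag_of (x, t) | x s t.
        x \<in> carrier M \<and> s \<in> carrier S \<and> t \<in> carrier S} \<union>
     {frag_of (x \<triangleleft>\<^bsub>M\<^esub> r, s) - frag_of (x, r \<otimes>\<^bsub>S\<^esub> s) | x r s.
        x \<in> carrier M \<and> r \<in> carrier R \<and> s \<in> carrier S}"

definition tensor_kernel ::
    "('s, 'x) ring_scheme \<Rightarrow> ('s, 'y) ring_scheme \<Rightarrow> ('s, 'm, 'z) right_module_scheme \<Rightarrow>
     ('m \<times> 's \<Rightarrow>\<^sub>0 int) set" where
  "tensor_kernel R S M = generate (tensor_free S M) (tensor_relators R S M)"

definition tensor_act ::
    "('s, 'y) ring_scheme \<Rightarrow> ('m \<times> 's \<Rightarrow>\<^sub>0 int) \<Rightarrow> 's \<Rightarrow> ('m \<times> 's \<Rightarrow>\<^sub>0 int)" where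
  "tensor_act S c t = frag_extend (\<lambda>(x, s). frag_of (x, s \<otimes>\<^bsub>S\<^esub> t)) c"

text \<open>The action on a coset \<open>X\<close> is the union of the cosets of \<open>c t\<close> for \<open>c \<in> X\<close>; these all
  coincide, the relations being stable under the action (compare \<^const>\<open>rcoset_mult\<close>).\<close>

definition tensor_module ::
    "('s, 'x) ring_scheme \<Rightarrow> ('s, 'y) ring_scheme \<Rightarrow> ('s, 'm, 'z) right_module_scheme \<Rightarrow>
     ('s, ('m \<times> 's \<Rightarrow>\<^sub>0 int) set) right_module" where
  "tensor_module R S M =
     (let Q = tensor_free S M Mod tensor_kernel R S M in
      \<lparr>carrier = carrier Q, mult = undefined, one = undefined, ring.zero = \<one>\<^bsub>Q\<^esub>, add = (\<otimes>\<^bsub>Q\<^esub>),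
       rsmult = (\<lambda>X t. \<Union>c\<in>X. tensor_kernel R S M #>\<^bsub>tensor_free S M\<^esub> tensor_act S c t)\<rparr>)"

end

theory Submission
  imports Defs "HOL-Algebra.Subrings"
begin

text \<open>Conditions (2), (3), (4) are linked through \<open>(I:G)\<close>, which is the largest invariant ideal inside
  the ideal \<open>I\<close>. In particular, if \<open>m (S\<^sub>g b S\<^sub>h) = 0\<close> for all \<open>g\<close> and \<open>h = g\<^sup>-\<^sup>1\<close>, then
  \<open>b \<in> (ann (mR) : G)\<close>. Under that assumption \<open>b\<close> also annihilates the \<open>S\<close>-module generated by
  \<open>m \<otimes> 1\<close>, so (1) implies (2).

  For (2) implies (1), let \<open>s\<close> annihilate a nonzero submodule \<open>N\<close> of \<open>M \<otimes>\<^sub>R S\<close>, graded by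
  \<open>M \<otimes> S\<^sub>g\<close>, and let \<open>t \<in> N\<close> be nonzero with support of least size. The unique product property,
  applied to the supports of a homogeneous multiple of \<open>t\<close> and of \<open>s\<close>, shows that every homogeneous
  component of \<open>s\<close> annihilates \<open>tS\<close>. Some \<open>a \<in> S\<^sub>h\<close> gives \<open>ta\<close> a nonzero component \<open>m \<otimes> 1\<close> of
  degree \<open>e\<close>, and (2) for this \<open>m\<close> shows that each component of \<open>s\<close> annihilates \<open>M \<otimes>\<^sub>R S\<close>.\<close>

subsection \<open>Spans of products\<close>

context ring
begin

lemma additive_subgroup_iff:
  "additive_subgroup H R \<longleftrightarrow>
     H \<subseteq> carrier R \<and> \<zero> \<in> H \<and> (\<forall>x\<in>H. \<ominus> x \<in> H) \<and> (\<forall>x\<in>H. \<forall>y\<in>H. x \<oplus> y \<in> H)"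
proof
  assume "additive_subgroup H R"
  then interpret additive_subgroup H R .
  show "H \<subseteq> carrier R \<and> \<zero> \<in> H \<and> (\<forall>x\<in>H. \<ominus> x \<in> H) \<and> (\<forall>x\<in>H. \<forall>y\<in>H. x \<oplus> y \<in> H)"
    using a_subset by (auto simp: subgroup.m_inv_closed[OF a_subgroup, folded a_inv_def])
next
  assume "H \<subseteq> carrier R \<and> \<zero> \<in> H \<and> (\<forall>x\<in>H. \<ominus> x \<in> H) \<and> (\<forall>x\<in>H. \<forall>y\<in>H. x \<oplus> y \<in> H)"
  then show "additive_subgroup H R"
    by (intro additive_subgroup.intro subgroup.intro) (auto simp: a_inv_def)
qed

text \<open>Lets a membership \<open>a w \<in> H\<close> with \<open>w\<close> in a span be checked
  on the generators of the span: the elements \<open>w\<close> that satisfy it form a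
  subgroup.\<close>

lemma additive_subgroup_vimage_left:
  assumes "additive_subgroup H R" "a \<in> carrier R"
  shows "additive_subgroup {x \<in> carrier R. a \<otimes> x \<in> H} R"
  using assms by (auto simp: additive_subgroup_iff r_distr r_minus)

lemma additive_subgroup_vimage_right:
  assumes "additive_subgroup H R" "a \<in> carrier R"
  shows "additive_subgroup {x \<in> carrier R. x \<otimes> a \<in> H} R"
  using assms by (auto simp: additive_subgroup_iff l_distr l_minus)

lemma span_mult_subgroup:
  assumes "X \<subseteq> carrier R" "Y \<subseteq> carrier R"
  shows "additive_subgroup (span_mult R X Y) R"
proof -
  have "X <#> Y \<subseteq> carrier R"
    using assms by (auto simp: set_mult_def subset_iff)
  then show ?thesis
    unfolding span_mult_def by (intro additive_subgroup.intro add.generate_is_subgroup) simp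
qed

lemma span_mult_carrier:
  "X \<subseteq> carrier R \<Longrightarrow> Y \<subseteq> carrier R \<Longrightarrow> span_mult R X Y \<subseteq> carrier R"
  by (rule additive_subgroup.a_subset[OF span_mult_subgroup])

lemma span_mult_incl: "x \<in> X \<Longrightarrow> y \<in> Y \<Longrightarrow> x \<otimes> y \<in> span_mult R X Y"
  unfolding span_mult_def by (rule generate.incl) (auto simp: set_mult_def)

lemma span_mult_least:
  assumes "additive_subgroup H R" "\<And>x y. x \<in> X \<Longrightarrow> y \<in> Y \<Longrightarrow> x \<otimes> y \<in> H"
  shows "span_mult R X Y \<subseteq> H"
  unfolding span_mult_def
  using assms(2)
  by (intro add.generate_subgroup_incl additive_subgroup.a_subgroup[OF assms(1)])
    (auto simp: set_mult_def)

lemma span_mult_mono: "X \<subseteq> X' \<Longrightarrow> Y \<subseteq> Y' \<Longrightarrow> span_mult R X Y \<subseteq> span_mult R X' Y'"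
  unfolding span_mult_def by (intro add.mono_generate) (auto simp: set_mult_def)

text \<open>Both sides are generated by the triple products \<open>x y z\<close>. Each inclusion
  fixes the outer factor and pulls the target subgroup back along multiplication by it, so that only
  generators of the inner span have to be tested.\<close>

lemma span_mult_assoc:
  assumes X: "X \<subseteq> carrier R" and Y: "Y \<subseteq> carrier R" and Z: "Z \<subseteq> carrier R"
  shows "span_mult R (span_mult R X Y) Z = span_mult R X (span_mult R Y Z)"
proof
  have 1: "additive_subgroup (span_mult R X (span_mult R Y Z)) R"
    using assms by (intro span_mult_subgroup span_mult_carrier)
  have "w \<otimes> z \<in> span_mult R X (span_mult R Y Z)" if w: "w \<in> span_mult R X Y" and z: "z \<in> Z" for w z
  proof -
    have "span_mult R X Y \<subseteq> {w \<in> carrier R. w \<otimes> z \<in> span_mult R X (span_mult R Y Z)}"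
      by (rule span_mult_least[OF additive_subgroup_vimage_right[OF 1]])
        (use z assms in \<open>auto simp: subset_iff m_assoc span_mult_incl\<close>)
    then show ?thesis using w by auto
  qed
  then show "span_mult R (span_mult R X Y) Z \<subseteq> span_mult R X (span_mult R Y Z)"
    by (rule span_mult_least[OF 1])
  have 2: "additive_subgroup (span_mult R (span_mult R X Y) Z) R"
    using assms by (intro span_mult_subgroup span_mult_carrier)
  have "x \<otimes> w \<in> span_mult R (span_mult R X Y) Z" if w: "w \<in> span_mult R Y Z" and x: "x \<in> X" for w x
  proof -
    have "span_mult R Y Z \<subseteq> {w \<in> carrier R. x \<otimes> w \<in> span_mult R (span_mult R X Y) Z}"
      by (rule span_mult_least[OF additive_subgroup_vimage_left[OF 2]])
        (use x assms in \<open>auto simp: subset_iff m_assoc[symmetric] span_mult_incl\<close>)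
    then show ?thesis using w by auto
  qed
  then show "span_mult R X (span_mult R Y Z) \<subseteq> span_mult R (span_mult R X Y) Z"
    by (intro span_mult_least[OF 2])
qed

end

subsection \<open>Right modules\<close>

context right_module
begin

lemma l_zero [simp]: "r \<in> carrier R \<Longrightarrow> \<zero>\<^bsub>M\<^esub> \<triangleleft>\<^bsub>M\<^esub> r = \<zero>\<^bsub>M\<^esub>"
  using rsmult_l_distr[of "\<zero>\<^bsub>M\<^esub>" "\<zero>\<^bsub>M\<^esub>" r] rsmult_closed[of "\<zero>\<^bsub>M\<^esub>" r]
  by (metis M.add.l_cancel_one' M.l_zero M.zero_closed)

lemma r_zero [simp]: "x \<in> carrier M \<Longrightarrow> x \<triangleleft>\<^bsub>M\<^esub> \<zero>\<^bsub>R\<^esub> = \<zero>\<^bsub>M\<^esub>"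
  using rsmult_r_distr[of x "\<zero>\<^bsub>R\<^esub>" "\<zero>\<^bsub>R\<^esub>"] rsmult_closed[of x "\<zero>\<^bsub>R\<^esub>"]
  by (metis M.add.l_cancel_one' R.l_zero R.zero_closed)

lemma r_minus:
  assumes "x \<in> carrier M" "r \<in> carrier R"
  shows "x \<triangleleft>\<^bsub>M\<^esub> (\<ominus>\<^bsub>R\<^esub> r) = \<ominus>\<^bsub>M\<^esub> (x \<triangleleft>\<^bsub>M\<^esub> r)"
  using rsmult_r_distr[of x "\<ominus>\<^bsub>R\<^esub> r" r] assms
  by (metis M.minus_equality R.add.inv_closed R.l_neg r_zero rsmult_closed)

lemma l_minus:
  assumes "x \<in> carrier M" "r \<in> carrier R"
  shows "(\<ominus>\<^bsub>M\<^esub> x) \<triangleleft>\<^bsub>M\<^esub> r = \<ominus>\<^bsub>M\<^esub> (x \<triangleleft>\<^bsub>M\<^esub> r)"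
  using rsmult_l_distr[of "\<ominus>\<^bsub>M\<^esub> x" x r] assms
  by (metis M.minus_equality M.add.inv_closed M.l_neg l_zero rsmult_closed)

text \<open>Typical use below: once this subgroup is shown to contain \<open>1\<close>, the element
  \<open>x\<close> is zero.\<close>

lemma point_annihilator_subgroup:
  assumes "x \<in> carrier M"
  shows "additive_subgroup {r \<in> carrier R. x \<triangleleft>\<^bsub>M\<^esub> r = \<zero>\<^bsub>M\<^esub>} R"
  unfolding R.additive_subgroup_iff using assms by (auto simp: r_minus rsmult_r_distr)

lemma submodule_subset: "right_submodule N R M \<Longrightarrow> N \<subseteq> carrier M"
  using subgroup.subset[of N "add_monoid M"] by (simp add: right_submodule_def)

text \<open>Closure under left multiplication comes from the action on \<open>N\<close>:
  \<open>n (r a) = (n r) a\<close>, and \<open>n r\<close> is again in \<open>N\<close>.\<close>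

lemma annihilator_ideal:
  assumes "right_submodule N R M"
  shows "ideal (annihilator R M N) R"
proof -
  interpret N: right_submodule N R M by fact
  have N: "n \<in> carrier M" if "n \<in> N" for n using that submodule_subset[OF assms] by auto
  have "additive_subgroup (annihilator R M N) R"
    unfolding R.additive_subgroup_iff using N by (auto simp: annihilator_def r_minus rsmult_r_distr)
  then show ?thesis
    unfolding ideal_def ideal_axioms_def using N N.rsmult_closed R.ring_axioms
    by (auto simp: annihilator_def rsmult_assoc)
qed

lemma carrier_submodule: "right_submodule (carrier M) R M"
  using M.add.subgroup_self rsmult_closed
  by (auto simp: right_submodule_def right_submodule_axioms_def)

lemma cyclic_submodule:
  assumes "x \<in> carrier M"
  shows "right_submodule ((\<lambda>r. x \<triangleleft>\<^bsub>M\<^esub> r) ` carrier R) R M"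
proof -
  have "subgroup ((\<lambda>r. x \<triangleleft>\<^bsub>M\<^esub> r) ` carrier R) (add_monoid M)"
  proof (rule M.add.subgroupI)
    fix a assume "a \<in> (\<lambda>r. x \<triangleleft>\<^bsub>M\<^esub> r) ` carrier R"
    then show "\<ominus>\<^bsub>M\<^esub> a \<in> (\<lambda>r. x \<triangleleft>\<^bsub>M\<^esub> r) ` carrier R"
      using assms by (auto simp: r_minus[symmetric])
  next
    fix a b assume "a \<in> (\<lambda>r. x \<triangleleft>\<^bsub>M\<^esub> r) ` carrier R" "b \<in> (\<lambda>r. x \<triangleleft>\<^bsub>M\<^esub> r) ` carrier R"
    then show "a \<oplus>\<^bsub>M\<^esub> b \<in> (\<lambda>r. x \<triangleleft>\<^bsub>M\<^esub> r) ` carrier R"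
      using assms by (auto simp: rsmult_r_distr[symmetric])
  qed (use assms rsmult_closed in auto)
  then show ?thesis
    using assms by (auto simp: right_submodule_def right_submodule_axioms_def rsmult_assoc[symmetric])
qed

lemma mem_cyclic: "x \<in> carrier M \<Longrightarrow> x \<in> (\<lambda>r. x \<triangleleft>\<^bsub>M\<^esub> r) ` carrier R"
  using rsmult_one R.one_closed by force

end

subsection \<open>The tensor product with an overring\<close>

text \<open>The base ring is \<open>S\<close> restricted to a subset \<open>K\<close>, so that its
  elements multiply those of \<open>S\<close> directly, without an embedding. That this restriction
  is a ring is part of \<open>right_module\<close>.\<close>

locale tensor_extension =
  S: ring S + right_module "S\<lparr>carrier := K\<rparr>" M
  for S :: "('s, 'y) ring_scheme" and K :: "'s set"
    and M :: "('s, 'm, 'z) right_module_scheme" +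
  assumes subset_carrier: "K \<subseteq> carrier S"
begin

abbreviation "TF \<equiv> tensor_free S M"
abbreviation "TK \<equiv> tensor_kernel (S\<lparr>carrier := K\<rparr>) S M"
abbreviation "T \<equiv> tensor_module (S\<lparr>carrier := K\<rparr>) S M"

definition tens :: "'m \<Rightarrow> 's \<Rightarrow> ('m \<times> 's \<Rightarrow>\<^sub>0 int) set" where
  "tens x s = TK #>\<^bsub>TF\<^esub> frag_of (x, s)"

lemma TF_comm_group: "comm_group TF"
  by (simp add: tensor_free_def abelian_free_Abelian_group)

lemma carrier_TF_iff: "c \<in> carrier TF \<longleftrightarrow> Poly_Mapping.keys c \<subseteq> carrier M \<times> carrier S"
  by (simp add: tensor_free_def)

lemma frag_of_in_TF [simp]: "frag_of (x, s) \<in> carrier TF \<longleftrightarrow> x \<in> carrier M \<and> s \<in> carrier S"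
  by (simp add: carrier_TF_iff)

lemma TF_ops [simp]:
  "x \<otimes>\<^bsub>TF\<^esub> y = x + y" "\<one>\<^bsub>TF\<^esub> = 0" "c \<in> carrier TF \<Longrightarrow> inv\<^bsub>TF\<^esub> c = - c"
  by (simp_all add: tensor_free_def)

lemma TF_uminus_closed [simp]: "c \<in> carrier TF \<Longrightarrow> - c \<in> carrier TF"
  by (simp add: carrier_TF_iff)

lemma TF_add_closed [simp]: "c \<in> carrier TF \<Longrightarrow> d \<in> carrier TF \<Longrightarrow> c + d \<in> carrier TF"
  using monoid.m_closed[of TF c d] TF_comm_group by (simp add: comm_group_def group_def)

lemma TF_diff_closed [simp]: "c \<in> carrier TF \<Longrightarrow> d \<in> carrier TF \<Longrightarrow> c - d \<in> carrier TF"
  using TF_add_closed[of c "- d"] by simp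

lemma relators_subset: "tensor_relators (S\<lparr>carrier := K\<rparr>) S M \<subseteq> carrier TF"
  unfolding tensor_relators_def
  using subset_carrier rsmult_closed by auto

lemma relator_add_left:
  "x \<in> carrier M \<Longrightarrow> y \<in> carrier M \<Longrightarrow> s \<in> carrier S \<Longrightarrow>
    frag_of (x \<oplus>\<^bsub>M\<^esub> y, s) - frag_of (x, s) - frag_of (y, s)
      \<in> tensor_relators (S\<lparr>carrier := K\<rparr>) S M"
  unfolding tensor_relators_def by blast

lemma relator_add_right:
  "x \<in> carrier M \<Longrightarrow> s \<in> carrier S \<Longrightarrow> t \<in> carrier S \<Longrightarrow>
    frag_of (x, s \<oplus>\<^bsub>S\<^esub> t) - frag_of (x, s) - frag_of (x, t)
      \<in> tensor_relators (S\<lparr>carrier := K\<rparr>) S M"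
  unfolding tensor_relators_def by blast

lemma relator_balanced:
  "x \<in> carrier M \<Longrightarrow> r \<in> K \<Longrightarrow> s \<in> carrier S \<Longrightarrow>
    frag_of (x \<triangleleft>\<^bsub>M\<^esub> r, s) - frag_of (x, r \<otimes>\<^bsub>S\<^esub> s)
      \<in> tensor_relators (S\<lparr>carrier := K\<rparr>) S M"
  unfolding tensor_relators_def by auto

section \<open>The relation subgroup and its cosets\<close>

lemma TK_subgroup: "subgroup TK TF"
proof -
  interpret TF: comm_group TF by (rule TF_comm_group)
  show ?thesis unfolding tensor_kernel_def by (rule TF.generate_is_subgroup[OF relators_subset])
qed

lemma TK_normal: "TK \<lhd> TF"
  by (simp add: TF_comm_group TK_subgroup comm_group.normal_iff_subgroup)

lemma relators_in_TK: "c \<in> tensor_relators (S\<lparr>carrier := K\<rparr>) S M \<Longrightarrow> c \<in> TK"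
  by (simp add: tensor_kernel_def generate.incl)

lemma coset_eq_iff:
  assumes "c \<in> carrier TF" "d \<in> carrier TF"
  shows "TK #>\<^bsub>TF\<^esub> c = TK #>\<^bsub>TF\<^esub> d \<longleftrightarrow> c - d \<in> TK"
proof -
  interpret TF: comm_group TF by (rule TF_comm_group)
  interpret TK: subgroup TK TF by (rule TK_subgroup)
  have "c - d \<in> TK \<longleftrightarrow> c \<in> TK #>\<^bsub>TF\<^esub> d"
    using TK.rcos_module[OF TF.is_group assms(2,1)] assms by simp
  then show ?thesis
    by (metis TF.rcos_self TF.repr_independence TK_subgroup assms)
qed

lemma T_carrier: "carrier T = (\<lambda>c. TK #>\<^bsub>TF\<^esub> c) ` carrier TF"
  by (simp add: tensor_module_def Let_def carrier_FactGroup)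

lemma T_zero: "\<zero>\<^bsub>T\<^esub> = TK"
  by (simp add: tensor_module_def Let_def)

lemma T_add:
  assumes "c \<in> carrier TF" "d \<in> carrier TF"
  shows "(TK #>\<^bsub>TF\<^esub> c) \<oplus>\<^bsub>T\<^esub> (TK #>\<^bsub>TF\<^esub> d) = TK #>\<^bsub>TF\<^esub> (c + d)"
  using normal.rcos_sum[OF TK_normal assms] by (simp add: tensor_module_def Let_def)

lemma T_abelian_group: "abelian_group T"
proof -
  interpret Q: comm_group "TF Mod TK"
    by (rule comm_group.abelian_FactGroup[OF TF_comm_group TK_subgroup])
  show ?thesis
    by (rule abelian_groupI)
      (use Q.m_closed Q.one_closed Q.m_assoc Q.m_comm Q.l_one Q.l_inv_ex
        in \<open>simp_all add: tensor_module_def Let_def del: mult_FactGroup one_FactGroup\<close>)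
qed

section \<open>The action of the overring on cosets\<close>

lemma tensor_act_diff: "tensor_act S (c - d) t = tensor_act S c t - tensor_act S d t"
  by (simp add: tensor_act_def frag_extend_diff)

lemma tensor_act_add: "tensor_act S (c + d) t = tensor_act S c t + tensor_act S d t"
  by (simp add: tensor_act_def frag_extend_add)

lemma tensor_act_frag_of [simp]: "tensor_act S (frag_of (x, s)) t = frag_of (x, s \<otimes>\<^bsub>S\<^esub> t)"
  by (simp add: tensor_act_def)

lemma tensor_act_closed:
  assumes "c \<in> carrier TF" "t \<in> carrier S"
  shows "tensor_act S c t \<in> carrier TF"
  using assms(1) unfolding carrier_TF_iff
proof (induction c rule: frag_induction)
  case zero
  show ?case by (simp add: tensor_act_def)
next
  case (one x)
  then show ?case using assms(2) by (cases x) auto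
next
  case (diff a b)
  then show ?case by (simp add: tensor_act_diff carrier_TF_iff[symmetric])
qed

text \<open>By distributivity and associativity in \<open>S\<close>, right multiplication by
  \<open>t\<close> sends each relator to a relator of the same type. This is what makes the action
  on cosets well defined.\<close>

lemma tensor_act_kernel:
  assumes t: "t \<in> carrier S" and "c \<in> TK"
  shows "tensor_act S c t \<in> TK"
proof -
  interpret TF: comm_group TF by (rule TF_comm_group)
  have rel: "tensor_act S h t \<in> tensor_relators (S\<lparr>carrier := K\<rparr>) S M"
    if "h \<in> tensor_relators (S\<lparr>carrier := K\<rparr>) S M" for h
    using that[unfolded tensor_relators_def]
  proof (elim UnE CollectE exE conjE, goal_cases)
    case (1 x y s)
    then show ?case using t by (simp add: tensor_act_diff relator_add_left)
  next
    case (2 x s u)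
    then show ?case using t by (simp add: tensor_act_diff S.l_distr relator_add_right)
  next
    case (3 x r s)
    then have "r \<in> carrier S" using subset_carrier by auto
    then show ?case using 3 t by (simp add: tensor_act_diff S.m_assoc relator_balanced)
  qed
  from assms(2) show ?thesis unfolding tensor_kernel_def
  proof (induction rule: generate.induct)
    case one
    show ?case using generate.one[of TF] by (simp add: tensor_act_def)
  next
    case (incl h)
    then show ?case using rel by (simp add: generate.incl)
  next
    case (inv h)
    have "h \<in> carrier TF" using inv relators_subset by auto
    then have "tensor_act S (inv\<^bsub>TF\<^esub> h) t = inv\<^bsub>TF\<^esub> (tensor_act S h t)"
      using t by (simp add: tensor_act_closed) (simp add: tensor_act_def frag_extend_minus)
    then show ?case using rel[OF inv] by (simp add: generate.inv)
  next
    case (eng h1 h2)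
    then show ?case using generate.eng[of _ TF] by (fastforce simp: tensor_act_add)
  qed
qed

text \<open>The union that defines the action is a union of equal cosets: for \<open>d\<close> in
  the coset of \<open>c\<close>, the difference \<open>d - c\<close> lies in the kernel and stays
  there under \<open>t\<close>. The index set contains \<open>c\<close>, so the union is that common
  coset.\<close>

lemma T_act:
  assumes c: "c \<in> carrier TF" and t: "t \<in> carrier S"
  shows "(TK #>\<^bsub>TF\<^esub> c) \<triangleleft>\<^bsub>T\<^esub> t = TK #>\<^bsub>TF\<^esub> tensor_act S c t"
proof -
  interpret TF: comm_group TF by (rule TF_comm_group)
  interpret TK: subgroup TK TF by (rule TK_subgroup)
  have "TK #>\<^bsub>TF\<^esub> tensor_act S d t = TK #>\<^bsub>TF\<^esub> tensor_act S c t" if d: "d \<in> TK #>\<^bsub>TF\<^esub> c" for d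
  proof -
    have dF: "d \<in> carrier TF" using TK.elemrcos_carrier[OF TF.is_group c d] .
    have "d - c \<in> TK" using TK.rcos_module_imp[OF TF.is_group c d] c by simp
    then have "tensor_act S d t - tensor_act S c t \<in> TK"
      using tensor_act_kernel[OF t] by (metis tensor_act_diff)
    then show ?thesis using c dF t by (simp add: coset_eq_iff tensor_act_closed)
  qed
  moreover have "c \<in> TK #>\<^bsub>TF\<^esub> c" using TF.rcos_self[OF c TK_subgroup] .
  ultimately have "(\<Union>d\<in>TK #>\<^bsub>TF\<^esub> c. TK #>\<^bsub>TF\<^esub> tensor_act S d t) = TK #>\<^bsub>TF\<^esub> tensor_act S c t"
    by blast
  then show ?thesis by (simp add: tensor_module_def Let_def)
qed

section \<open>Elementary tensors\<close>

lemma tens_closed [simp]: "x \<in> carrier M \<Longrightarrow> s \<in> carrier S \<Longrightarrow> tens x s \<in> carrier T"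
  by (simp add: T_carrier tens_def)

lemma tens_add_left:
  assumes "x \<in> carrier M" "y \<in> carrier M" "s \<in> carrier S"
  shows "tens (x \<oplus>\<^bsub>M\<^esub> y) s = tens x s \<oplus>\<^bsub>T\<^esub> tens y s"
proof -
  have "frag_of (x \<oplus>\<^bsub>M\<^esub> y, s) - frag_of (x, s) - frag_of (y, s) \<in> TK"
    using assms by (intro relators_in_TK relator_add_left)
  then show ?thesis using assms by (simp add: tens_def T_add coset_eq_iff diff_diff_eq)
qed

lemma tens_add_right:
  assumes "x \<in> carrier M" "s \<in> carrier S" "t \<in> carrier S"
  shows "tens x (s \<oplus>\<^bsub>S\<^esub> t) = tens x s \<oplus>\<^bsub>T\<^esub> tens x t"
proof -
  have "frag_of (x, s \<oplus>\<^bsub>S\<^esub> t) - frag_of (x, s) - frag_of (x, t) \<in> TK"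
    using assms by (intro relators_in_TK relator_add_right)
  then show ?thesis using assms by (simp add: tens_def T_add coset_eq_iff diff_diff_eq)
qed

lemma tens_balanced:
  assumes "x \<in> carrier M" "r \<in> K" "s \<in> carrier S"
  shows "tens (x \<triangleleft>\<^bsub>M\<^esub> r) s = tens x (r \<otimes>\<^bsub>S\<^esub> s)"
proof -
  have "frag_of (x \<triangleleft>\<^bsub>M\<^esub> r, s) - frag_of (x, r \<otimes>\<^bsub>S\<^esub> s) \<in> TK"
    using assms by (intro relators_in_TK relator_balanced)
  moreover have "r \<in> carrier S" "x \<triangleleft>\<^bsub>M\<^esub> r \<in> carrier M"
    using assms subset_carrier rsmult_closed[of x r] by auto
  ultimately show ?thesis using assms by (simp add: tens_def coset_eq_iff)
qed

lemma tens_act: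
  assumes "x \<in> carrier M" "s \<in> carrier S" "t \<in> carrier S"
  shows "tens x s \<triangleleft>\<^bsub>T\<^esub> t = tens x (s \<otimes>\<^bsub>S\<^esub> t)"
  using assms by (simp add: tens_def T_act)

lemma tens_zero_left:
  assumes "s \<in> carrier S"
  shows "tens \<zero>\<^bsub>M\<^esub> s = \<zero>\<^bsub>T\<^esub>"
proof -
  interpret T: abelian_group T by (rule T_abelian_group)
  show ?thesis using tens_add_left[of "\<zero>\<^bsub>M\<^esub>" "\<zero>\<^bsub>M\<^esub>" s] assms
      T.add.l_cancel_one'[of "tens \<zero>\<^bsub>M\<^esub> s" "tens \<zero>\<^bsub>M\<^esub> s"] by simp
qed

lemma tens_zero_right:
  assumes "x \<in> carrier M"
  shows "tens x \<zero>\<^bsub>S\<^esub> = \<zero>\<^bsub>T\<^esub>"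
proof -
  interpret T: abelian_group T by (rule T_abelian_group)
  show ?thesis using tens_add_right[of x "\<zero>\<^bsub>S\<^esub>" "\<zero>\<^bsub>S\<^esub>"] assms
      T.add.l_cancel_one'[of "tens x \<zero>\<^bsub>S\<^esub>" "tens x \<zero>\<^bsub>S\<^esub>"] by simp
qed

text \<open>Negatives fall under the case \<open>tens\<close>, because the negative of
  \<open>x \<otimes> s\<close> is the elementary tensor \<open>(- x) \<otimes> s\<close>.\<close>

lemma tens_induct [consumes 1, case_names tens add]:
  assumes "t \<in> carrier T"
    and tens: "\<And>x s. x \<in> carrier M \<Longrightarrow> s \<in> carrier S \<Longrightarrow> P (tens x s)"
    and add: "\<And>t u. t \<in> carrier T \<Longrightarrow> u \<in> carrier T \<Longrightarrow> P t \<Longrightarrow> P u \<Longrightarrow> P (t \<oplus>\<^bsub>T\<^esub> u)"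
  shows "P t"
proof -
  interpret T: abelian_group T by (rule T_abelian_group)
  \<comment> \<open>\<open>frag_induction\<close> builds elements by differences, while
    \<open>add\<close> offers only sums. The predicate therefore carries the coset of
    \<open>- c\<close> along with that of \<open>c\<close>.\<close>
  let ?Q = "\<lambda>c. c \<in> carrier TF \<and> P (TK #>\<^bsub>TF\<^esub> c) \<and> P (TK #>\<^bsub>TF\<^esub> (- c))"
  have "?Q c" if "Poly_Mapping.keys c \<subseteq> carrier M \<times> carrier S" for c
    using that
  proof (induction c rule: frag_induction)
    case zero
    interpret TF: comm_group TF by (rule TF_comm_group)
    have "TK #>\<^bsub>TF\<^esub> 0 = \<zero>\<^bsub>T\<^esub>"
      using TF.coset_mult_one[of TK] subgroup.subset[OF TK_subgroup] by (simp add: T_zero)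
    then show ?case using tens[of "\<zero>\<^bsub>M\<^esub>" "\<zero>\<^bsub>S\<^esub>"] by (simp add: tens_zero_left carrier_TF_iff)
  next
    case (one z)
    obtain x s where z: "z = (x, s)" "x \<in> carrier M" "s \<in> carrier S" using one by auto
    have 1: "tens (\<ominus>\<^bsub>M\<^esub> x) s \<oplus>\<^bsub>T\<^esub> tens x s = \<zero>\<^bsub>T\<^esub>"
      using z tens_add_left[of "\<ominus>\<^bsub>M\<^esub> x" x s] by (simp add: tens_zero_left M.l_neg)
    have 2: "(TK #>\<^bsub>TF\<^esub> (- frag_of z)) \<oplus>\<^bsub>T\<^esub> tens x s = \<zero>\<^bsub>T\<^esub>"
    proof -
      interpret TF: comm_group TF by (rule TF_comm_group)
      show ?thesis using z TF.coset_mult_one[of TK] subgroup.subset[OF TK_subgroup]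
        by (simp add: tens_def T_add T_zero)
    qed
    have "TK #>\<^bsub>TF\<^esub> (- frag_of z) \<in> carrier T" using z by (simp add: T_carrier)
    then have "TK #>\<^bsub>TF\<^esub> (- frag_of z) = tens (\<ominus>\<^bsub>M\<^esub> x) s"
      using 1 2 z by (metis M.add.inv_closed T.minus_equality tens_closed)
    then show ?case using tens z by (auto simp flip: tens_def)
  next
    case (diff a b)
    have "P (TK #>\<^bsub>TF\<^esub> (a + - b))"
      unfolding T_add[of a "- b", symmetric, OF conjunct1[OF diff(1)] TF_uminus_closed[OF conjunct1[OF diff(2)]]]
      using diff by (intro add) (auto simp: T_carrier)
    moreover have "P (TK #>\<^bsub>TF\<^esub> (b + - a))"
      unfolding T_add[of b "- a", symmetric, OF conjunct1[OF diff(2)] TF_uminus_closed[OF conjunct1[OF diff(1)]]]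
      using diff by (intro add) (auto simp: T_carrier)
    ultimately show ?case using diff by simp
  qed
  then show ?thesis using assms(1) by (auto simp: T_carrier carrier_TF_iff)
qed

text \<open>Unit law, associativity and additivity in the module argument hold already for
  representatives in the free group. Additivity in the ring argument holds only modulo the relators,
  hence the induction over tensors.\<close>

lemma tensor_right_module: "right_module S T"
proof -
  interpret T: abelian_group T by (rule T_abelian_group)
  have one: "tensor_act S c \<one>\<^bsub>S\<^esub> = c" if "c \<in> carrier TF" for c
    using that unfolding carrier_TF_iff
    by (induction c rule: frag_induction) (auto simp: tensor_act_diff, simp add: tensor_act_def)
  have assoc: "tensor_act S c (s \<otimes>\<^bsub>S\<^esub> t) = tensor_act S (tensor_act S c s) t"
    if "c \<in> carrier TF" "s \<in> carrier S" "t \<in> carrier S" for c s t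
    using that(1) unfolding carrier_TF_iff
    by (induction c rule: frag_induction)
      (use that(2,3) in \<open>auto simp: tensor_act_diff S.m_assoc\<close>, simp add: tensor_act_def)
  have ldistr: "(x \<oplus>\<^bsub>T\<^esub> y) \<triangleleft>\<^bsub>T\<^esub> r = x \<triangleleft>\<^bsub>T\<^esub> r \<oplus>\<^bsub>T\<^esub> y \<triangleleft>\<^bsub>T\<^esub> r"
    if "x \<in> carrier T" "y \<in> carrier T" "r \<in> carrier S" for x y r
    using that by (auto simp: T_carrier T_add T_act tensor_act_closed tensor_act_add)
  show ?thesis
  proof unfold_locales
    fix x r s assume x: "x \<in> carrier T" and rs: "r \<in> carrier S" "s \<in> carrier S"
    show "x \<triangleleft>\<^bsub>T\<^esub> r \<in> carrier T"
      using x rs by (auto simp: T_carrier T_act tensor_act_closed)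
    show "x \<triangleleft>\<^bsub>T\<^esub> (r \<otimes>\<^bsub>S\<^esub> s) = (x \<triangleleft>\<^bsub>T\<^esub> r) \<triangleleft>\<^bsub>T\<^esub> s"
      using x rs by (auto simp: T_carrier T_act tensor_act_closed assoc)
    show "x \<triangleleft>\<^bsub>T\<^esub> (r \<oplus>\<^bsub>S\<^esub> s) = x \<triangleleft>\<^bsub>T\<^esub> r \<oplus>\<^bsub>T\<^esub> x \<triangleleft>\<^bsub>T\<^esub> s"
      using x
    proof (induction rule: tens_induct)
      case (tens x t)
      then show ?case using rs by (simp add: tens_act S.r_distr tens_add_right)
    next
      case (add t u)
      have c: "v \<triangleleft>\<^bsub>T\<^esub> a \<in> carrier T" if "v \<in> carrier T" "a \<in> carrier S" for v a
        using that by (auto simp: T_carrier T_act tensor_act_closed)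
      show ?case using add rs by (simp add: ldistr c T.a_ac)
    qed
  next
    fix x assume "x \<in> carrier T"
    then show "x \<triangleleft>\<^bsub>T\<^esub> \<one>\<^bsub>S\<^esub> = x" by (auto simp: T_carrier T_act one)
  qed (use ldistr in auto)
qed

section \<open>The universal property\<close>

text \<open>Source of the homomorphisms \<open>base_part\<close> and \<open>proj\<close> below. The
  map is extended to the free abelian group, shown to kill the relators, and factored through the
  quotient.\<close>

lemma tensor_universal:
  assumes "comm_group H"
    and f: "\<And>x s. x \<in> carrier M \<Longrightarrow> s \<in> carrier S \<Longrightarrow> f x s \<in> carrier H"
    and add_left: "\<And>x y s. x \<in> carrier M \<Longrightarrow> y \<in> carrier M \<Longrightarrow> s \<in> carrier S \<Longrightarrow>
          f (x \<oplus>\<^bsub>M\<^esub> y) s = f x s \<otimes>\<^bsub>H\<^esub> f y s"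
    and add_right: "\<And>x s t. x \<in> carrier M \<Longrightarrow> s \<in> carrier S \<Longrightarrow> t \<in> carrier S \<Longrightarrow>
          f x (s \<oplus>\<^bsub>S\<^esub> t) = f x s \<otimes>\<^bsub>H\<^esub> f x t"
    and balanced: "\<And>x r s. x \<in> carrier M \<Longrightarrow> r \<in> K \<Longrightarrow> s \<in> carrier S \<Longrightarrow>
          f (x \<triangleleft>\<^bsub>M\<^esub> r) s = f x (r \<otimes>\<^bsub>S\<^esub> s)"
  obtains h where "h \<in> hom (add_monoid T) H"
    "\<And>x s. x \<in> carrier M \<Longrightarrow> s \<in> carrier S \<Longrightarrow> h (tens x s) = f x s"
proof -
  interpret H: comm_group H by fact
  interpret TF: comm_group TF by (rule TF_comm_group)
  have "case_prod f ` (carrier M \<times> carrier S) \<subseteq> carrier H" using f by auto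
  then obtain h where h: "h \<in> hom TF H"
    and hf': "\<And>z. z \<in> carrier M \<times> carrier S \<Longrightarrow> h (frag_of z) = case_prod f z"
    using H.free_Abelian_group_universal unfolding tensor_free_def by blast
  have hf: "h (frag_of (x, s)) = f x s" if "x \<in> carrier M" "s \<in> carrier S" for x s
    using hf'[of "(x, s)"] that by simp
  interpret h: group_hom TF H h
    using h by (simp add: group_hom_axioms_def group_hom_def)
  have h_diff: "h (c - d) = h c \<otimes>\<^bsub>H\<^esub> inv\<^bsub>H\<^esub> (h d)" if "c \<in> carrier TF" "d \<in> carrier TF" for c d
    using that h.hom_mult[of c "- d"] h.hom_inv[of d] by simp
  have "TK \<subseteq> kernel TF H h"
    unfolding tensor_kernel_def
  proof (rule TF.generate_subgroup_incl[OF _ h.subgroup_kernel], rule subsetI)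
    fix c assume c: "c \<in> tensor_relators (S\<lparr>carrier := K\<rparr>) S M"
    \<comment> \<open>The relators that express additivity in either argument are sent to elements
      of this shape, which are trivial because \<open>H\<close> is commutative.\<close>
    have *: "(a \<otimes>\<^bsub>H\<^esub> b) \<otimes>\<^bsub>H\<^esub> inv\<^bsub>H\<^esub> a \<otimes>\<^bsub>H\<^esub> inv\<^bsub>H\<^esub> b = \<one>\<^bsub>H\<^esub>"
      if "a \<in> carrier H" "b \<in> carrier H" for a b
      using that H.inv_mult[of a b] H.r_inv[of "a \<otimes>\<^bsub>H\<^esub> b"] by (simp add: H.m_assoc)
    have "h c = \<one>\<^bsub>H\<^esub>"
      using c unfolding tensor_relators_def
    proof (elim UnE CollectE exE conjE, goal_cases)
      case (1 x y s) then show ?case by (simp add: h_diff hf add_left * f)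
    next
      case (2 x s t) then show ?case by (simp add: h_diff hf add_right * f)
    next
      case (3 x r s) then show ?case using subset_carrier rsmult_closed[of x r]
        by (simp add: h_diff hf balanced f subset_iff)
    qed
    then show "c \<in> kernel TF H h" using c relators_subset by (auto simp: kernel_def)
  qed
  then have "h c = h d"
    if "c \<in> carrier TF" "d \<in> carrier TF" "TK #>\<^bsub>TF\<^esub> c = TK #>\<^bsub>TF\<^esub> d" for c d
  proof -
    have "c - d \<in> TK" using that coset_eq_iff by blast
    then have "h (c - d) = \<one>\<^bsub>H\<^esub>" using \<open>TK \<subseteq> _\<close> by (auto simp: kernel_def)
    then have "h c \<otimes>\<^bsub>H\<^esub> inv\<^bsub>H\<^esub> (h d) = \<one>\<^bsub>H\<^esub>" using that h_diff by simp
    then show ?thesis using that H.right_cancel[of "inv\<^bsub>H\<^esub> (h d)" "h c" "h d"] by simp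
  qed
  then obtain g where g: "g \<in> hom (TF Mod TK) H" "\<And>c. c \<in> carrier TF \<Longrightarrow> g (TK #>\<^bsub>TF\<^esub> c) = h c"
    using FactGroup_universal[OF h TK_normal] by metis
  show thesis
  proof
    show "g \<in> hom (add_monoid T) H"
      using g(1) by (simp add: hom_def tensor_module_def Let_def)
    show "g (tens x s) = f x s" if "x \<in> carrier M" "s \<in> carrier S" for x s
      using that by (simp add: tens_def g(2) hf)
  qed
qed

end

subsection \<open>Conjugates and cores of ideals in graded rings\<close>

context graded_ring
begin

abbreviation base_ring where "base_ring \<equiv> S\<lparr>carrier := A \<one>\<^bsub>G\<^esub>\<rparr>"

lemma component_iff:
  assumes "g \<in> carrier G"
  shows "A g \<subseteq> carrier S" "\<zero>\<^bsub>S\<^esub> \<in> A g" "x \<in> A g \<Longrightarrow> \<ominus>\<^bsub>S\<^esub> x \<in> A g"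
    "x \<in> A g \<Longrightarrow> y \<in> A g \<Longrightarrow> x \<oplus>\<^bsub>S\<^esub> y \<in> A g"
  using component_subgroup[OF assms] by (auto simp: S.additive_subgroup_iff)

lemma component_carrier: "g \<in> carrier G \<Longrightarrow> x \<in> A g \<Longrightarrow> x \<in> carrier S"
  using component_iff by auto

lemma component_mult_mem:
  "g \<in> carrier G \<Longrightarrow> h \<in> carrier G \<Longrightarrow> x \<in> A g \<Longrightarrow> y \<in> A h \<Longrightarrow> x \<otimes>\<^bsub>S\<^esub> y \<in> A (g \<otimes>\<^bsub>G\<^esub> h)"
  using component_mult S.span_mult_incl by blast

lemma component_one_left:
  "g \<in> carrier G \<Longrightarrow> x \<in> A \<one>\<^bsub>G\<^esub> \<Longrightarrow> y \<in> A g \<Longrightarrow> x \<otimes>\<^bsub>S\<^esub> y \<in> A g"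
  using component_mult_mem[of "\<one>\<^bsub>G\<^esub>" g] by simp

lemma component_one_right:
  "g \<in> carrier G \<Longrightarrow> x \<in> A g \<Longrightarrow> y \<in> A \<one>\<^bsub>G\<^esub> \<Longrightarrow> x \<otimes>\<^bsub>S\<^esub> y \<in> A g"
  using component_mult_mem[of g "\<one>\<^bsub>G\<^esub>"] by simp

lemma base_ring: "ring base_ring"
proof -
  have "subring (A \<one>\<^bsub>G\<^esub>) S"
    using component_iff[of "\<one>\<^bsub>G\<^esub>"] one_component component_one_left[of "\<one>\<^bsub>G\<^esub>"]
    by (intro S.subringI) auto
  then show ?thesis by (rule S.subring_is_ring)
qed

lemma additive_subgroup_base_ring_iff:
  "additive_subgroup H base_ring \<longleftrightarrow> additive_subgroup H S \<and> H \<subseteq> A \<one>\<^bsub>G\<^esub>"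
proof -
  interpret base: ring base_ring by (rule base_ring)
  \<comment> \<open>The additive inverse is defined through the carrier, so its agreement in
    \<open>S\<close> and in the restricted ring has to be proved.\<close>
  have "\<ominus>\<^bsub>base_ring\<^esub> x = \<ominus>\<^bsub>S\<^esub> x" if "x \<in> A \<one>\<^bsub>G\<^esub>" for x
    using that component_iff[of "\<one>\<^bsub>G\<^esub>"]
    by (intro base.minus_equality) (auto simp: S.l_neg component_carrier)
  then show ?thesis
    unfolding base.additive_subgroup_iff S.additive_subgroup_iff
    using component_iff[of "\<one>\<^bsub>G\<^esub>"] by (auto simp: subset_iff)
qed

lemma ideal_base_ring_iff:
  "ideal I base_ring \<longleftrightarrow> additive_subgroup I S \<and> I \<subseteq> A \<one>\<^bsub>G\<^esub> \<and>
     (\<forall>x\<in>I. \<forall>r\<in>A \<one>\<^bsub>G\<^esub>. r \<otimes>\<^bsub>S\<^esub> x \<in> I \<and> x \<otimes>\<^bsub>S\<^esub> r \<in> I)"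
  unfolding ideal_def ideal_axioms_def using additive_subgroup_base_ring_iff base_ring by auto

end

context strongly_graded_ring
begin

lemma conj_span_mono: "X \<subseteq> Y \<Longrightarrow> conj_span G S A g X \<subseteq> conj_span G S A g Y"
  unfolding conj_span_def by (intro S.span_mult_mono) auto

text \<open>After regrouping by associativity, strong grading merges the outer components on each
  side: \<open>A g\<close> with \<open>A h\<close> on the left, and the components of the inverse
  degrees on the right. Together with \<open>conj_span_one\<close> this makes conjugation an action
  of the group on the ideals of the base ring.\<close>

lemma conj_span_conj_span:
  assumes g: "g \<in> carrier G" and h: "h \<in> carrier G" and X: "X \<subseteq> carrier S"
  shows "conj_span G S A g (conj_span G S A h X) = conj_span G S A (g \<otimes>\<^bsub>G\<^esub> h) X"
proof -
  note [simp] = component_iff(1)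
  have "conj_span G S A g (conj_span G S A h X) =
     span_mult S (span_mult S (span_mult S (A g) (A h)) X) (span_mult S (A (inv\<^bsub>G\<^esub> h)) (A (inv\<^bsub>G\<^esub> g)))"
    using assms by (simp add: conj_span_def S.span_mult_assoc S.span_mult_carrier)
  also have "\<dots> = conj_span G S A (g \<otimes>\<^bsub>G\<^esub> h) X"
    using g h by (simp add: component_mult_eq conj_span_def G.inv_mult_group)
  finally show ?thesis .
qed

text \<open>Multiplication by the base ring is absorbed by the outer component on either side, since
  the component of degree \<open>e\<close> times \<open>A g\<close> is \<open>A g\<close>. The
  statement is about subsets so that it covers a singleton \<open>{b}\<close>.\<close>

lemma conj_span_ideal:
  assumes g: "g \<in> carrier G" and X: "X \<subseteq> A \<one>\<^bsub>G\<^esub>"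
  shows "ideal (conj_span G S A g X) base_ring"
proof -
  note [simp] = component_iff(1)
  have XS: "X \<subseteq> carrier S" using X component_carrier[of "\<one>\<^bsub>G\<^esub>"] by auto
  have 1: "additive_subgroup (conj_span G S A g X) S"
    unfolding conj_span_def using g XS by (intro S.span_mult_subgroup S.span_mult_carrier) auto
  have "span_mult S (A g) X \<subseteq> A g"
    by (rule S.span_mult_least[OF component_subgroup[OF g]]) (use X g component_one_right in auto)
  then have "conj_span G S A g X \<subseteq> span_mult S (A g) (A (inv\<^bsub>G\<^esub> g))"
    unfolding conj_span_def by (intro S.span_mult_mono) auto
  then have 2: "conj_span G S A g X \<subseteq> A \<one>\<^bsub>G\<^esub>" using g by (simp add: component_mult_eq)
  have "span_mult S (A \<one>\<^bsub>G\<^esub>) (conj_span G S A g X) =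
      span_mult S (span_mult S (span_mult S (A \<one>\<^bsub>G\<^esub>) (A g)) X) (A (inv\<^bsub>G\<^esub> g))"
    using g XS by (simp add: conj_span_def S.span_mult_assoc S.span_mult_carrier)
  then have 3: "span_mult S (A \<one>\<^bsub>G\<^esub>) (conj_span G S A g X) = conj_span G S A g X"
    using g by (simp add: component_mult_eq conj_span_def)
  have "span_mult S (conj_span G S A g X) (A \<one>\<^bsub>G\<^esub>) =
      span_mult S (span_mult S (A g) X) (span_mult S (A (inv\<^bsub>G\<^esub> g)) (A \<one>\<^bsub>G\<^esub>))"
    using g XS by (simp add: conj_span_def S.span_mult_assoc S.span_mult_carrier)
  then have 4: "span_mult S (conj_span G S A g X) (A \<one>\<^bsub>G\<^esub>) = conj_span G S A g X"
    using g by (simp add: component_mult_eq conj_span_def)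
  show ?thesis unfolding ideal_base_ring_iff using 1 2 3 4 S.span_mult_incl by blast
qed

lemma mem_conj_span_one:
  assumes "x \<in> X" "X \<subseteq> A \<one>\<^bsub>G\<^esub>"
  shows "x \<in> conj_span G S A \<one>\<^bsub>G\<^esub> X"
proof -
  have "x \<in> carrier S" using assms component_carrier[of "\<one>\<^bsub>G\<^esub>"] by auto
  then show ?thesis
    using S.span_mult_incl[OF S.span_mult_incl[OF one_component assms(1)] one_component]
    by (simp add: conj_span_def)
qed

lemma conj_span_one:
  assumes "ideal I base_ring"
  shows "conj_span G S A \<one>\<^bsub>G\<^esub> I = I"
proof
  have I: "additive_subgroup I S" "I \<subseteq> A \<one>\<^bsub>G\<^esub>"
    "\<And>x r. x \<in> I \<Longrightarrow> r \<in> A \<one>\<^bsub>G\<^esub> \<Longrightarrow> r \<otimes>\<^bsub>S\<^esub> x \<in> I \<and> x \<otimes>\<^bsub>S\<^esub> r \<in> I"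
    using assms unfolding ideal_base_ring_iff by auto
  have "span_mult S (A \<one>\<^bsub>G\<^esub>) I \<subseteq> I" by (rule S.span_mult_least) (use I in auto)
  then show "conj_span G S A \<one>\<^bsub>G\<^esub> I \<subseteq> I"
    unfolding conj_span_def by (intro S.span_mult_least) (use I in auto)
qed (use assms mem_conj_span_one in \<open>auto simp: ideal_base_ring_iff\<close>)

lemma G_core_ideal:
  assumes "I \<subseteq> A \<one>\<^bsub>G\<^esub>"
  shows "ideal (G_core G S A I) base_ring"
proof -
  have *: "\<And>g. g \<in> carrier G \<Longrightarrow> additive_subgroup (conj_span G S A g I) S"
    and **: "\<And>g x r. g \<in> carrier G \<Longrightarrow> x \<in> conj_span G S A g I \<Longrightarrow> r \<in> A \<one>\<^bsub>G\<^esub> \<Longrightarrow>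
      r \<otimes>\<^bsub>S\<^esub> x \<in> conj_span G S A g I \<and> x \<otimes>\<^bsub>S\<^esub> r \<in> conj_span G S A g I"
    and "conj_span G S A \<one>\<^bsub>G\<^esub> I \<subseteq> A \<one>\<^bsub>G\<^esub>"
    using conj_span_ideal[OF _ assms] by (simp_all add: ideal_base_ring_iff)
  then have 1: "G_core G S A I \<subseteq> A \<one>\<^bsub>G\<^esub>" by (auto simp: G_core_def)
  have "additive_subgroup (G_core G S A I) S"
    unfolding S.additive_subgroup_iff
  proof (intro conjI ballI)
    show "G_core G S A I \<subseteq> carrier S" using 1 component_iff(1)[of "\<one>\<^bsub>G\<^esub>"] by auto
  qed (use * in \<open>auto simp: G_core_def S.additive_subgroup_iff\<close>)
  then show ?thesis using 1 ** by (auto simp: ideal_base_ring_iff G_core_def)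
qed

lemma G_core_subset:
  assumes "ideal I base_ring"
  shows "G_core G S A I \<subseteq> I"
  unfolding G_core_def using conj_span_one[OF assms] by auto

text \<open>Conjugation by \<open>h\<close> permutes the conjugates of \<open>I\<close>: the core
  lies in the conjugate by \<open>inv h \<otimes> g\<close>, and conjugating by \<open>h\<close>
  carries this one to the conjugate by \<open>g\<close>.\<close>

lemma conj_span_G_core_subset:
  assumes h: "h \<in> carrier G" and I: "I \<subseteq> A \<one>\<^bsub>G\<^esub>"
  shows "conj_span G S A h (G_core G S A I) \<subseteq> G_core G S A I"
proof -
  have IS: "I \<subseteq> carrier S" using I component_iff(1)[of "\<one>\<^bsub>G\<^esub>"] by auto
  have "conj_span G S A h (G_core G S A I) \<subseteq> conj_span G S A g I" if g: "g \<in> carrier G" for g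
  proof -
    have "G_core G S A I \<subseteq> conj_span G S A (inv\<^bsub>G\<^esub> h \<otimes>\<^bsub>G\<^esub> g) I"
      unfolding G_core_def using g h by auto
    then have "conj_span G S A h (G_core G S A I)
        \<subseteq> conj_span G S A h (conj_span G S A (inv\<^bsub>G\<^esub> h \<otimes>\<^bsub>G\<^esub> g) I)"
      by (rule conj_span_mono)
    then show ?thesis using g h IS by (simp add: conj_span_conj_span G.m_assoc[symmetric])
  qed
  then show ?thesis by (auto simp: G_core_def)
qed

lemma G_core_invariant:
  assumes "I \<subseteq> A \<one>\<^bsub>G\<^esub>"
  shows "G_invariant G S A (G_core G S A I)"
  unfolding G_invariant_def
proof (intro ballI equalityI conj_span_G_core_subset assms)
  fix h assume h: "h \<in> carrier G"
  let ?J = "G_core G S A I"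
  have J: "ideal ?J base_ring" by (rule G_core_ideal[OF assms])
  then have JS: "?J \<subseteq> carrier S" by (auto simp: ideal_base_ring_iff S.additive_subgroup_iff)
  \<comment> \<open>For the reverse inclusion, write the core as the \<open>h\<close>-conjugate of
    its conjugate by the inverse of \<open>h\<close>, and apply the first inclusion to the inner
    one.\<close>
  have "?J = conj_span G S A h (conj_span G S A (inv\<^bsub>G\<^esub> h) ?J)"
    using h JS J by (simp add: conj_span_conj_span conj_span_one)
  also have "\<dots> \<subseteq> conj_span G S A h ?J"
    using h assms by (intro conj_span_mono conj_span_G_core_subset) auto
  finally show "?J \<subseteq> conj_span G S A h ?J" .
qed auto

lemma invariant_subset_G_core:
  assumes "G_invariant G S A J" "J \<subseteq> I"
  shows "J \<subseteq> G_core G S A I"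
proof -
  have "J \<subseteq> conj_span G S A g I" if "g \<in> carrier G" for g
    using assms that conj_span_mono[of J I g] by (auto simp: G_invariant_def)
  then show ?thesis by (auto simp: G_core_def)
qed

text \<open>The bridge from the elementwise condition to cores: \<open>b\<close> lies in its
  conjugate of degree \<open>e\<close>, which is the \<open>g\<close>-conjugate of the conjugate of
  \<open>{b}\<close> by \<open>inv g\<close>, and the latter is contained in
  \<open>I\<close>.\<close>

lemma mem_G_core:
  assumes b: "b \<in> A \<one>\<^bsub>G\<^esub>" and I: "\<And>g. g \<in> carrier G \<Longrightarrow> conj_span G S A g {b} \<subseteq> I"
  shows "b \<in> G_core G S A I"
proof -
  have bS: "{b} \<subseteq> carrier S" using b component_carrier[of "\<one>\<^bsub>G\<^esub>"] by auto
  have "b \<in> conj_span G S A g I" if g: "g \<in> carrier G" for g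
  proof -
    have "b \<in> conj_span G S A g (conj_span G S A (inv\<^bsub>G\<^esub> g) {b})"
      using g bS mem_conj_span_one[of b "{b}"] b by (simp add: conj_span_conj_span)
    then show ?thesis using conj_span_mono[OF I, of "inv\<^bsub>G\<^esub> g" g] g by auto
  qed
  then show ?thesis by (auto simp: G_core_def)
qed

end

subsection \<open>Homogeneous components\<close>

context graded_ring
begin

definition component_sum where
  "component_sum = sum_group (carrier G) (\<lambda>g. add_monoid (S\<lparr>carrier := A g\<rparr>))"

text \<open>With components read off from the inverse of the summation isomorphism, their additivity
  is the homomorphism property of that inverse.\<close>

definition hcomp :: "'g \<Rightarrow> 's \<Rightarrow> 's" where
  "hcomp g s = inv_into (carrier component_sum)
     (\<lambda>f. gfinprod (add_monoid S) f (carrier G)) s g"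

lemma component_add_group: "g \<in> carrier G \<Longrightarrow> group (add_monoid (S\<lparr>carrier := A g\<rparr>))"
  using S.add.subgroup_imp_group[OF additive_subgroup.a_subgroup[OF component_subgroup]] by simp

lemma carrier_component_sum:
  "carrier component_sum = {x \<in> \<Pi>\<^sub>E g\<in>carrier G. A g. finite {g \<in> carrier G. x g \<noteq> \<zero>\<^bsub>S\<^esub>}}"
  unfolding component_sum_def
  using carrier_sum_group[of "carrier G" "\<lambda>g. add_monoid (S\<lparr>carrier := A g\<rparr>)", OF component_add_group]
  by simp

lemma iso_component_sum:
  "(\<lambda>f. gfinprod (add_monoid S) f (carrier G)) \<in> iso component_sum (add_monoid S)"
  using direct_sum by (simp add: component_sum_def)

lemma hcomp_family:
  assumes "s \<in> carrier S"
  shows "(\<lambda>g. hcomp g s) \<in> carrier component_sum"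
    "gfinprod (add_monoid S) (\<lambda>g. hcomp g s) (carrier G) = s"
proof -
  let ?\<Phi> = "\<lambda>f. gfinprod (add_monoid S) f (carrier G)"
  have surj: "?\<Phi> ` carrier component_sum = carrier S"
    using iso_component_sum by (auto simp: iso_def bij_betw_def)
  then have s: "s \<in> ?\<Phi> ` carrier component_sum" using assms by simp
  show "(\<lambda>g. hcomp g s) \<in> carrier component_sum"
    unfolding hcomp_def using inv_into_into[OF s] by (simp add: eta_contract_eq)
  show "?\<Phi> (\<lambda>g. hcomp g s) = s"
    unfolding hcomp_def using f_inv_into_f[OF s] by (simp add: eta_contract_eq)
qed

lemma hcomp_closed: "s \<in> carrier S \<Longrightarrow> g \<in> carrier G \<Longrightarrow> hcomp g s \<in> A g"
  using hcomp_family(1) by (auto simp: carrier_component_sum)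

lemma hcomp_add:
  assumes "s \<in> carrier S" "t \<in> carrier S" "g \<in> carrier G"
  shows "hcomp g (s \<oplus>\<^bsub>S\<^esub> t) = hcomp g s \<oplus>\<^bsub>S\<^esub> hcomp g t"
proof -
  let ?\<psi> = "inv_into (carrier component_sum) (\<lambda>f. gfinprod (add_monoid S) f (carrier G))"
  have "group component_sum"
    unfolding component_sum_def by (rule sum_group) (rule component_add_group)
  then have "?\<psi> \<in> iso (add_monoid S) component_sum"
    by (rule group.iso_set_sym[OF _ iso_component_sum])
  then have "?\<psi> (s \<oplus>\<^bsub>S\<^esub> t) = ?\<psi> s \<otimes>\<^bsub>component_sum\<^esub> ?\<psi> t"
    using assms by (auto simp: iso_def hom_def)
  then show ?thesis using assms by (simp add: hcomp_def component_sum_def)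
qed

text \<open>The family with the single entry \<open>u\<close> in degree \<open>h\<close> sums to
  \<open>u\<close>, so by injectivity of summation it is the family of components of
  \<open>u\<close>.\<close>

lemma hcomp_homogeneous:
  assumes h: "h \<in> carrier G" and u: "u \<in> A h" and g: "g \<in> carrier G"
  shows "hcomp g u = (if g = h then u else \<zero>\<^bsub>S\<^esub>)"
proof -
  let ?\<Phi> = "\<lambda>f. gfinprod (add_monoid S) f (carrier G)"
  let ?d = "\<lambda>k\<in>carrier G. if k = h then u else \<zero>\<^bsub>S\<^esub>"
  have A: "\<And>k. k \<in> carrier G \<Longrightarrow> \<zero>\<^bsub>S\<^esub> \<in> A k" and uS: "u \<in> carrier S"
    using component_iff component_carrier h u by auto
  have "finite {k \<in> carrier G. ?d k \<noteq> \<zero>\<^bsub>S\<^esub>}" by (rule finite_subset[of _ "{h}"]) auto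
  then have d: "?d \<in> carrier component_sum" using A u by (auto simp: carrier_component_sum)
  have "?\<Phi> ?d = gfinprod (add_monoid S) ?d {h}"
    by (rule S.add.gfinprod_mono_neutral_cong_right) (use h uS in auto)
  also have "\<dots> = u" using h uS by (subst S.add.gfinprod_eq_finprod) auto
  finally have "inv_into (carrier component_sum) ?\<Phi> u = ?d"
    using inv_into_f_f[OF _ d, of ?\<Phi>] iso_component_sum by (simp add: iso_def bij_betw_def)
  then show ?thesis using g by (simp add: hcomp_def)
qed

lemma homogeneous_decomposition:
  assumes "s \<in> carrier S"
  obtains Y where "finite Y" "Y \<subseteq> carrier G" "s = finsum S (\<lambda>g. hcomp g s) Y"
proof
  let ?Y = "{g \<in> carrier G. hcomp g s \<noteq> \<zero>\<^bsub>S\<^esub>}"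
  have *: "hcomp g s \<in> carrier S" if "g \<in> carrier G" for g
    using hcomp_closed[OF assms that] component_carrier[OF that] by auto
  show fin: "finite ?Y" using hcomp_family(1)[OF assms] by (simp add: carrier_component_sum)
  have "s = gfinprod (add_monoid S) (\<lambda>g. hcomp g s) (carrier G)"
    using hcomp_family(2)[OF assms] by simp
  \<comment> \<open>\<open>gfinprod\<close> over the possibly infinite group reads only the support
    of the family; on the finite set \<open>?Y\<close> it then becomes an ordinary
    \<open>finsum\<close>.\<close>
  also have "\<dots> = gfinprod (add_monoid S) (\<lambda>g. hcomp g s) ?Y"
    by (rule S.add.gfinprod_mono_neutral_cong_right) (use * in auto)
  also have "\<dots> = finsum S (\<lambda>g. hcomp g s) ?Y"
    using fin * by (intro S.add.gfinprod_eq_finprod) auto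
  finally show "s = finsum S (\<lambda>g. hcomp g s) ?Y" .
qed auto

lemma homogeneous_induct [consumes 1, case_names homogeneous add]:
  assumes "s \<in> carrier S"
    and hom: "\<And>g u. g \<in> carrier G \<Longrightarrow> u \<in> A g \<Longrightarrow> P u"
    and add: "\<And>s t. s \<in> carrier S \<Longrightarrow> t \<in> carrier S \<Longrightarrow> P s \<Longrightarrow> P t \<Longrightarrow> P (s \<oplus>\<^bsub>S\<^esub> t)"
  shows "P s"
proof -
  have *: "hcomp g s \<in> A g" "hcomp g s \<in> carrier S" if "g \<in> carrier G" for g
    using hcomp_closed[OF assms(1) that] component_carrier[OF that] by auto
  \<comment> \<open>The empty sum is treated as a homogeneous element of degree
    \<open>e\<close>.\<close>
  have "\<zero>\<^bsub>S\<^esub> \<in> A \<one>\<^bsub>G\<^esub>"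
    using component_iff by simp
  obtain Y where Y: "finite Y" "Y \<subseteq> carrier G" "s = finsum S (\<lambda>g. hcomp g s) Y"
    using homogeneous_decomposition[OF assms(1)] .
  have "P (finsum S (\<lambda>g. hcomp g s) Y)" using Y(1,2)
  proof (induction Y rule: finite_induct)
    case empty
    then show ?case using hom[OF G.one_closed \<open>\<zero>\<^bsub>S\<^esub> \<in> A \<one>\<^bsub>G\<^esub>\<close>] by simp
  next
    case (insert g F)
    then have g: "g \<in> carrier G" and F: "(\<lambda>g. hcomp g s) \<in> F \<rightarrow> carrier S" using * by auto
    have "P (hcomp g s \<oplus>\<^bsub>S\<^esub> finsum S (\<lambda>g. hcomp g s) F)"
      using insert.IH insert.prems F by (intro add *(2)[OF g] hom[OF g *(1)[OF g]] S.finsum_closed) auto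
    then show ?case using S.finsum_insert[OF insert.hyps F] * g by simp
  qed
  then show ?thesis using Y(3) by simp
qed

lemma hcomp_carrier: "s \<in> carrier S \<Longrightarrow> g \<in> carrier G \<Longrightarrow> hcomp g s \<in> carrier S"
  using hcomp_closed component_carrier by blast

text \<open>By additivity it suffices to take \<open>s\<close> homogeneous of some degree
  \<open>k\<close>; then \<open>k h = g h\<close> holds exactly when \<open>k = g\<close>.\<close>

lemma hcomp_mult_right:
  assumes s: "s \<in> carrier S" and g: "g \<in> carrier G" and h: "h \<in> carrier G" and u: "u \<in> A h"
  shows "hcomp (g \<otimes>\<^bsub>G\<^esub> h) (s \<otimes>\<^bsub>S\<^esub> u) = hcomp g s \<otimes>\<^bsub>S\<^esub> u"
  using s
proof (induction rule: homogeneous_induct)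
  case (homogeneous k v)
  then show ?case
    using hcomp_homogeneous[OF _ component_mult_mem[OF _ h _ u]] g h
      component_carrier[OF h u] by (simp add: hcomp_homogeneous)
next
  case (add s t)
  then show ?case using component_carrier[OF h u] g h
    by (simp add: hcomp_add hcomp_carrier S.l_distr)
qed

text \<open>Supplies the balancedness over the base ring of the two maps from which
  \<open>base_part\<close> and \<open>proj\<close> are built.\<close>

lemma hcomp_mult_left:
  assumes s: "s \<in> carrier S" and g: "g \<in> carrier G" and r: "r \<in> A \<one>\<^bsub>G\<^esub>"
  shows "hcomp g (r \<otimes>\<^bsub>S\<^esub> s) = r \<otimes>\<^bsub>S\<^esub> hcomp g s"
  using s
proof (induction rule: homogeneous_induct)
  case (homogeneous k v)
  then show ?case
    using hcomp_homogeneous[OF _ component_one_left[OF _ r]] g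
      component_carrier[OF _ r] by (simp add: hcomp_homogeneous)
next
  case (add s t)
  then show ?case using component_carrier[OF _ r] g
    by (simp add: hcomp_add hcomp_carrier S.r_distr)
qed

end

text \<open>Strong grading makes \<open>1\<close> a sum of products \<open>a u\<close> with factors
  of inverse degrees. Taking for \<open>H\<close> the annihilator of an element \<open>z\<close>,
  one obtains \<open>z = 0\<close> as soon as \<open>z a u = 0\<close> for all such \<open>a\<close>
  and \<open>u\<close>; this is the cancellation device of the later proofs.\<close>

lemma (in strongly_graded_ring) one_mem_if_products_mem:
  assumes g: "g \<in> carrier G" and H: "additive_subgroup H S"
    and "\<And>a u. a \<in> A (inv\<^bsub>G\<^esub> g) \<Longrightarrow> u \<in> A g \<Longrightarrow> a \<otimes>\<^bsub>S\<^esub> u \<in> H"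
  shows "\<one>\<^bsub>S\<^esub> \<in> H"
proof -
  have "span_mult S (A (inv\<^bsub>G\<^esub> g)) (A g) \<subseteq> H" by (rule S.span_mult_least[OF H assms(3)])
  then show ?thesis using component_mult_eq[of "inv\<^bsub>G\<^esub> g" g] g one_component by auto
qed

subsection \<open>Elementwise, idealwise and annihilator forms of primeness\<close>

locale strongly_graded_module = strongly_graded_ring G S A + right_module "S\<lparr>carrier := A \<one>\<^bsub>G\<^esub>\<rparr>" M
  for G :: "('g, 'x) monoid_scheme" and S :: "('s, 'y) ring_scheme" and A :: "'g \<Rightarrow> 's set"
    and M :: "('s, 'm, 'z) right_module_scheme"

sublocale strongly_graded_module \<subseteq> tensor_extension S "A \<one>\<^bsub>G\<^esub>" M
  by unfold_locales (rule component_iff(1)[OF G.one_closed])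

context strongly_graded_module
begin

definition elementwise_G_prime :: bool where
  "elementwise_G_prime \<longleftrightarrow> (\<forall>m\<in>carrier M. \<forall>b\<in>A \<one>\<^bsub>G\<^esub>.
     (\<forall>g\<in>carrier G. \<forall>r\<in>conj_span G S A g {b}. m \<triangleleft>\<^bsub>M\<^esub> r = \<zero>\<^bsub>M\<^esub>) \<longrightarrow>
     m = \<zero>\<^bsub>M\<^esub> \<or> (\<forall>x\<in>carrier M. x \<triangleleft>\<^bsub>M\<^esub> b = \<zero>\<^bsub>M\<^esub>))"

definition idealwise_G_prime :: bool where
  "idealwise_G_prime \<longleftrightarrow> (\<forall>m\<in>carrier M. \<forall>B. ideal B base_ring \<and> G_invariant G S A B \<longrightarrow>
     (\<forall>b\<in>B. m \<triangleleft>\<^bsub>M\<^esub> b = \<zero>\<^bsub>M\<^esub>) \<longrightarrow>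
     m = \<zero>\<^bsub>M\<^esub> \<or> (\<forall>x\<in>carrier M. \<forall>b\<in>B. x \<triangleleft>\<^bsub>M\<^esub> b = \<zero>\<^bsub>M\<^esub>))"

definition annihilator_G_prime :: bool where
  "annihilator_G_prime \<longleftrightarrow> (\<forall>N. right_submodule N base_ring M \<and> N \<noteq> {\<zero>\<^bsub>M\<^esub>} \<longrightarrow>
     G_core G S A (annihilator base_ring M N) = G_core G S A (annihilator base_ring M (carrier M)))"

lemma annihilator_subset: "annihilator base_ring M N \<subseteq> A \<one>\<^bsub>G\<^esub>"
  by (auto simp: annihilator_def)

text \<open>By invariance all conjugates of \<open>{b}\<close> with \<open>b \<in> B\<close> stay
  inside \<open>B\<close> and so kill \<open>m\<close>. The elementwise condition then applies to
  each \<open>b\<close> separately.\<close>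

lemma elementwise_imp_idealwise:
  assumes elementwise_G_prime
  shows idealwise_G_prime
  unfolding idealwise_G_prime_def
proof (intro ballI allI impI, elim conjE)
  fix m B assume m: "m \<in> carrier M" and B: "ideal B base_ring" "G_invariant G S A B"
    and mB: "\<forall>b\<in>B. m \<triangleleft>\<^bsub>M\<^esub> b = \<zero>\<^bsub>M\<^esub>"
  have "conj_span G S A g {b} \<subseteq> B" if "b \<in> B" "g \<in> carrier G" for b g
    using conj_span_mono[of "{b}" B g] that B(2) by (auto simp: G_invariant_def)
  moreover have "B \<subseteq> A \<one>\<^bsub>G\<^esub>" using B(1) by (simp add: ideal_base_ring_iff)
  ultimately show "m = \<zero>\<^bsub>M\<^esub> \<or> (\<forall>x\<in>carrier M. \<forall>b\<in>B. x \<triangleleft>\<^bsub>M\<^esub> b = \<zero>\<^bsub>M\<^esub>)"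
    using assms m mB unfolding elementwise_G_prime_def by blast
qed

text \<open>The core \<open>B\<close> of \<open>ann N\<close> is an invariant ideal that kills some
  nonzero \<open>m \<in> N\<close>, hence it kills \<open>M\<close>. Being invariant and contained
  in \<open>ann M\<close>, it lies in the core of \<open>ann M\<close>. The other inclusion is
  monotonicity.\<close>

lemma idealwise_imp_annihilator:
  assumes idealwise_G_prime
  shows annihilator_G_prime
  unfolding annihilator_G_prime_def
proof (intro allI impI, elim conjE)
  fix N assume N: "right_submodule N base_ring M" "N \<noteq> {\<zero>\<^bsub>M\<^esub>}"
  let ?I = "annihilator base_ring M N" and ?J = "annihilator base_ring M (carrier M)"
  let ?B = "G_core G S A ?I"
  have "?J \<subseteq> ?I" using submodule_subset[OF N(1)] by (auto simp: annihilator_def)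
  then have 1: "G_core G S A ?J \<subseteq> ?B"
    unfolding G_core_def by (intro INF_mono) (blast dest: conj_span_mono)
  interpret N: right_submodule N base_ring M by fact
  have "\<zero>\<^bsub>M\<^esub> \<in> N" using N.one_closed by simp
  then obtain m where m: "m \<in> N" "m \<noteq> \<zero>\<^bsub>M\<^esub>" using N(2) by blast
  have "m \<in> carrier M" using m submodule_subset[OF N(1)] by blast
  have B: "ideal ?B base_ring" "G_invariant G S A ?B" "?B \<subseteq> ?I"
    using G_core_ideal G_core_invariant annihilator_subset G_core_subset annihilator_ideal[OF N(1)]
    by auto
  then have "\<forall>b\<in>?B. m \<triangleleft>\<^bsub>M\<^esub> b = \<zero>\<^bsub>M\<^esub>" using m(1) by (auto simp: annihilator_def)
  then have "\<forall>x\<in>carrier M. \<forall>b\<in>?B. x \<triangleleft>\<^bsub>M\<^esub> b = \<zero>\<^bsub>M\<^esub>"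
    using assms \<open>m \<in> carrier M\<close> m(2) B(1,2) unfolding idealwise_G_prime_def by blast
  then have "?B \<subseteq> ?J" using B(3) by (auto simp: annihilator_def)
  then show "?B = G_core G S A ?J" using 1 invariant_subset_G_core[OF B(2)] by blast
qed

text \<open>The condition is applied to \<open>N = m R\<close>. Each conjugate of \<open>{b}\<close>
  is an ideal that kills \<open>m\<close>, so it kills \<open>m R\<close>, and \<open>b\<close> lies
  in the core of \<open>ann N\<close>. That core equals the core of \<open>ann M\<close>, which is
  contained in \<open>ann M\<close>.\<close>

lemma annihilator_imp_elementwise:
  assumes annihilator_G_prime
  shows elementwise_G_prime
  unfolding elementwise_G_prime_def
proof (intro ballI impI, rule disj_imp[THEN iffD2], rule impI)
  fix m b assume m: "m \<in> carrier M" and b: "b \<in> A \<one>\<^bsub>G\<^esub>"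
    and mb: "\<forall>g\<in>carrier G. \<forall>r\<in>conj_span G S A g {b}. m \<triangleleft>\<^bsub>M\<^esub> r = \<zero>\<^bsub>M\<^esub>"
    and m0: "m \<noteq> \<zero>\<^bsub>M\<^esub>"
  let ?N = "(\<lambda>r. m \<triangleleft>\<^bsub>M\<^esub> r) ` carrier base_ring"
  let ?J = "annihilator base_ring M (carrier M)"
  have N: "right_submodule ?N base_ring M" "m \<in> ?N" by (fact cyclic_submodule[OF m] mem_cyclic[OF m])+
  have "conj_span G S A g {b} \<subseteq> annihilator base_ring M ?N" if g: "g \<in> carrier G" for g
  proof -
    have "ideal (conj_span G S A g {b}) base_ring" using conj_span_ideal[OF g] b by simp
    then show ?thesis
      using mb g m by (auto simp: annihilator_def ideal_base_ring_iff rsmult_assoc[symmetric, simplified])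
  qed
  then have "b \<in> G_core G S A (annihilator base_ring M ?N)"
    by (rule mem_G_core[OF b])
  also have "\<dots> = G_core G S A ?J"
    using assms N m0 unfolding annihilator_G_prime_def by blast
  also have "\<dots> \<subseteq> ?J" by (rule G_core_subset[OF annihilator_ideal[OF carrier_submodule]])
  finally show "\<forall>x\<in>carrier M. x \<triangleleft>\<^bsub>M\<^esub> b = \<zero>\<^bsub>M\<^esub>" by (simp add: annihilator_def)
qed

end

lemma unique_productE:
  assumes "unique_product_group G" "finite X" "X \<noteq> {}" "X \<subseteq> carrier G"
    "finite Y" "Y \<noteq> {}" "Y \<subseteq> carrier G"
  obtains x y where "x \<in> X" "y \<in> Y"
    "\<And>x' y'. x' \<in> X \<Longrightarrow> y' \<in> Y \<Longrightarrow> (x', y') \<noteq> (x, y) \<Longrightarrow> x \<otimes>\<^bsub>G\<^esub> y \<noteq> x' \<otimes>\<^bsub>G\<^esub> y'"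
proof -
  have "\<exists>x\<in>X. \<exists>y\<in>Y. \<forall>x'\<in>X. \<forall>y'\<in>Y. (x', y') \<noteq> (x, y) \<longrightarrow> x \<otimes>\<^bsub>G\<^esub> y \<noteq> x' \<otimes>\<^bsub>G\<^esub> y'"
    using assms unfolding unique_product_group_def by simp
  then show thesis using that by blast
qed

subsection \<open>The induced grading of the tensor product\<close>

context strongly_graded_module
begin

interpretation T: right_module S T by (rule tensor_right_module)

lemma homogeneous_tens_induct [consumes 1, case_names tens add]:
  assumes "t \<in> carrier T"
    and tens: "\<And>x g u. x \<in> carrier M \<Longrightarrow> g \<in> carrier G \<Longrightarrow> u \<in> A g \<Longrightarrow> P (tens x u)"
    and add: "\<And>t u. t \<in> carrier T \<Longrightarrow> u \<in> carrier T \<Longrightarrow> P t \<Longrightarrow> P u \<Longrightarrow> P (t \<oplus>\<^bsub>T\<^esub> u)"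
  shows "P t"
  using assms(1)
proof (induction rule: tens_induct)
  case (tens x s)
  from tens(2) show ?case
  proof (induction rule: homogeneous_induct)
    case (homogeneous g u)
    then show ?case using assms(2) tens by simp
  next
    case (add s t)
    then show ?case using assms(3) tens by (simp add: tens_add_right)
  qed
qed (rule add)

lemma base_part_exists:
  "\<exists>h. h \<in> hom (add_monoid T) (add_monoid M) \<and>
     (\<forall>x\<in>carrier M. \<forall>s\<in>carrier S. h (tens x s) = x \<triangleleft>\<^bsub>M\<^esub> hcomp \<one>\<^bsub>G\<^esub> s)"
proof -
  have *: "hcomp \<one>\<^bsub>G\<^esub> s \<in> carrier base_ring" if "s \<in> carrier S" for s
    using hcomp_closed that by simp
  have r: "r \<in> carrier S" if "r \<in> A \<one>\<^bsub>G\<^esub>" for r using component_carrier that by blast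
  obtain h where "h \<in> hom (add_monoid T) (add_monoid M)"
     "\<And>x s. x \<in> carrier M \<Longrightarrow> s \<in> carrier S \<Longrightarrow> h (tens x s) = x \<triangleleft>\<^bsub>M\<^esub> hcomp \<one>\<^bsub>G\<^esub> s"
    using tensor_universal[of "add_monoid M" "\<lambda>x s. x \<triangleleft>\<^bsub>M\<^esub> hcomp \<one>\<^bsub>G\<^esub> s"] M.a_comm_group
      rsmult_closed[OF _ *] rsmult_l_distr[OF _ _ *] rsmult_r_distr[OF _ * *] rsmult_assoc[OF _ _ *]
    by (simp add: hcomp_add hcomp_mult_left) (metis r)
  then show ?thesis by blast
qed

text \<open>The projection onto the part of degree \<open>e\<close>, identified with
  \<open>M\<close>. It is picked by choice because the universal property asserts existence only;
  additivity and the values on elementary tensors determine it on the tensor product.\<close>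

definition base_part where
  "base_part = (SOME h. h \<in> hom (add_monoid T) (add_monoid M) \<and>
     (\<forall>x\<in>carrier M. \<forall>s\<in>carrier S. h (tens x s) = x \<triangleleft>\<^bsub>M\<^esub> hcomp \<one>\<^bsub>G\<^esub> s))"

lemma base_part_hom: "base_part \<in> hom (add_monoid T) (add_monoid M)"
  and base_part_tens: "x \<in> carrier M \<Longrightarrow> s \<in> carrier S \<Longrightarrow> base_part (tens x s) = x \<triangleleft>\<^bsub>M\<^esub> hcomp \<one>\<^bsub>G\<^esub> s"
  using someI_ex[OF base_part_exists] unfolding base_part_def by auto

lemma proj_exists:
  assumes g: "g \<in> carrier G"
  shows "\<exists>h. h \<in> hom (add_monoid T) (add_monoid T) \<and>
     (\<forall>x\<in>carrier M. \<forall>s\<in>carrier S. h (tens x s) = tens x (hcomp g s))"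
proof -
  have r: "r \<in> carrier S" if "r \<in> A \<one>\<^bsub>G\<^esub>" for r using component_carrier that by blast
  obtain h where "h \<in> hom (add_monoid T) (add_monoid T)"
     "\<And>x s. x \<in> carrier M \<Longrightarrow> s \<in> carrier S \<Longrightarrow> h (tens x s) = tens x (hcomp g s)"
    using tensor_universal[of "add_monoid T" "\<lambda>x s. tens x (hcomp g s)"] T.M.a_comm_group g
    by (simp add: hcomp_add hcomp_mult_left hcomp_carrier tens_add_left tens_add_right tens_balanced)
      metis
  then show ?thesis by blast
qed

text \<open>The projection onto \<open>M \<otimes> S\<^sub>g\<close>, by which the tensor product
  inherits the grading of \<open>S\<close>.\<close>

definition proj where
  "proj g = (SOME h. h \<in> hom (add_monoid T) (add_monoid T) \<and>
     (\<forall>x\<in>carrier M. \<forall>s\<in>carrier S. h (tens x s) = tens x (hcomp g s)))"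

lemma proj_hom: "g \<in> carrier G \<Longrightarrow> proj g \<in> hom (add_monoid T) (add_monoid T)"
  and proj_tens: "g \<in> carrier G \<Longrightarrow> x \<in> carrier M \<Longrightarrow> s \<in> carrier S \<Longrightarrow>
    proj g (tens x s) = tens x (hcomp g s)"
  using someI_ex[OF proj_exists] unfolding proj_def by auto

lemma base_part_closed [simp]: "t \<in> carrier T \<Longrightarrow> base_part t \<in> carrier M"
  and base_part_add: "t \<in> carrier T \<Longrightarrow> u \<in> carrier T \<Longrightarrow> base_part (t \<oplus>\<^bsub>T\<^esub> u) = base_part t \<oplus>\<^bsub>M\<^esub> base_part u"
  and base_part_zero [simp]: "base_part \<zero>\<^bsub>T\<^esub> = \<zero>\<^bsub>M\<^esub>"
  using base_part_hom hom_one[OF base_part_hom] T.M.a_group M.a_group by (auto simp: hom_def)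

lemma proj_closed [simp]: "g \<in> carrier G \<Longrightarrow> t \<in> carrier T \<Longrightarrow> proj g t \<in> carrier T"
  and proj_add: "g \<in> carrier G \<Longrightarrow> t \<in> carrier T \<Longrightarrow> u \<in> carrier T \<Longrightarrow>
    proj g (t \<oplus>\<^bsub>T\<^esub> u) = proj g t \<oplus>\<^bsub>T\<^esub> proj g u"
  and proj_zero [simp]: "g \<in> carrier G \<Longrightarrow> proj g \<zero>\<^bsub>T\<^esub> = \<zero>\<^bsub>T\<^esub>"
  using proj_hom hom_one[OF proj_hom] T.M.a_group by (auto simp: hom_def)

lemma base_part_tens_base:
  assumes "x \<in> carrier M" "r \<in> A \<one>\<^bsub>G\<^esub>"
  shows "base_part (tens x r) = x \<triangleleft>\<^bsub>M\<^esub> r"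
  using assms component_carrier[OF _ assms(2)] by (simp add: base_part_tens hcomp_homogeneous[OF G.one_closed])

lemma base_part_act:
  assumes t: "t \<in> carrier T" and r: "r \<in> A \<one>\<^bsub>G\<^esub>"
  shows "base_part (t \<triangleleft>\<^bsub>T\<^esub> r) = base_part t \<triangleleft>\<^bsub>M\<^esub> r"
  using t
proof (induction rule: tens_induct)
  case (tens x s)
  have "r \<in> carrier S" using component_carrier[OF _ r] by simp
  then show ?case using tens r hcomp_mult_right[of s "\<one>\<^bsub>G\<^esub>" "\<one>\<^bsub>G\<^esub>" r]
      rsmult_assoc[of x "hcomp \<one>\<^bsub>G\<^esub> s" r] hcomp_closed[of s "\<one>\<^bsub>G\<^esub>"]
    by (simp add: tens_act base_part_tens)
next
  case (add t u)
  have "r \<in> carrier S" using component_carrier[OF _ r] by simp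
  then show ?case using add r rsmult_l_distr[of "base_part t" "base_part u" r]
    by (simp add: T.rsmult_l_distr T.rsmult_closed base_part_add)
qed

lemma proj_act:
  assumes t: "t \<in> carrier T" and g: "g \<in> carrier G" and h: "h \<in> carrier G" and u: "u \<in> A h"
  shows "proj (g \<otimes>\<^bsub>G\<^esub> h) (t \<triangleleft>\<^bsub>T\<^esub> u) = proj g t \<triangleleft>\<^bsub>T\<^esub> u"
  using t
proof (induction rule: tens_induct)
  case (tens x s)
  then show ?case using component_carrier[OF h u] g h u
    by (simp add: tens_act proj_tens hcomp_mult_right hcomp_carrier)
next
  case (add t v)
  then show ?case using component_carrier[OF h u] g h
    by (simp add: T.rsmult_l_distr T.rsmult_closed proj_add)
qed

text \<open>For \<open>a\<close> of degree \<open>inv g\<close> and \<open>u\<close> of degree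
  \<open>g\<close>, acting by \<open>a\<close> and then \<open>u\<close> on the component of
  \<open>t\<close> in degree \<open>g\<close> gives \<open>base_part (t a) \<otimes> u\<close>. If
  all these base parts vanish, the component is killed by every \<open>a u\<close>, hence by
  \<open>1\<close>. In contrapositive form, a nonzero component can be moved to degree
  \<open>e\<close>.\<close>

lemma proj_eq_zeroI:
  assumes t: "t \<in> carrier T" and g: "g \<in> carrier G"
    and base_part0: "\<And>a. a \<in> A (inv\<^bsub>G\<^esub> g) \<Longrightarrow> base_part (t \<triangleleft>\<^bsub>T\<^esub> a) = \<zero>\<^bsub>M\<^esub>"
  shows "proj g t = \<zero>\<^bsub>T\<^esub>"
proof -
  have c: "\<And>a. a \<in> A (inv\<^bsub>G\<^esub> g) \<Longrightarrow> a \<in> carrier S" "\<And>u. u \<in> A g \<Longrightarrow> u \<in> carrier S"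
    using component_carrier g by blast+
  have eq: "(proj g t \<triangleleft>\<^bsub>T\<^esub> a) \<triangleleft>\<^bsub>T\<^esub> u = tens (base_part (t \<triangleleft>\<^bsub>T\<^esub> a)) u"
    if a: "a \<in> A (inv\<^bsub>G\<^esub> g)" and u: "u \<in> A g" for a u
    using t
  proof (induction rule: tens_induct)
    case (tens x s)
    then show ?case using a u c g hcomp_mult_right[of s g "inv\<^bsub>G\<^esub> g" a] hcomp_closed[of "s \<otimes>\<^bsub>S\<^esub> a" "\<one>\<^bsub>G\<^esub>"]
      by (simp add: proj_tens tens_act hcomp_carrier base_part_tens tens_balanced)
  next
    case (add t v)
    then show ?case using a u c g
      by (simp add: T.rsmult_l_distr T.rsmult_closed proj_add base_part_add tens_add_left)
  qed
  have "\<one>\<^bsub>S\<^esub> \<in> {r \<in> carrier S. proj g t \<triangleleft>\<^bsub>T\<^esub> r = \<zero>\<^bsub>T\<^esub>}"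
    using t g c eq base_part0
    by (intro one_mem_if_products_mem[OF g] T.point_annihilator_subgroup)
      (auto simp: T.rsmult_assoc tens_zero_left)
  then show ?thesis using t g by (simp add: T.rsmult_one)
qed

section \<open>Supports of elements of the tensor product\<close>

definition supp where
  "supp t = {g \<in> carrier G. proj g t \<noteq> \<zero>\<^bsub>T\<^esub>}"

text \<open>A finite set \<open>F\<close> that merely contains the support is used because the
  finiteness of \<open>supp\<close> is derived from it. Summation over every larger finite set is
  demanded so that two elements can be expanded over a common index set when they are added.\<close>

definition supported_on where
  "supported_on t F \<longleftrightarrow> finite F \<and> F \<subseteq> carrier G \<and>
    (\<forall>g\<in>carrier G - F. proj g t = \<zero>\<^bsub>T\<^esub>) \<and>
    (\<forall>F'. finite F' \<longrightarrow> F \<subseteq> F' \<longrightarrow> F' \<subseteq> carrier G \<longrightarrow> t = finsum T (\<lambda>g. proj g t) F')"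

lemma supported_onD:
  assumes "supported_on t F"
  shows "finite F" "F \<subseteq> carrier G" "\<And>g. g \<in> carrier G \<Longrightarrow> g \<notin> F \<Longrightarrow> proj g t = \<zero>\<^bsub>T\<^esub>"
    "\<And>F'. finite F' \<Longrightarrow> F \<subseteq> F' \<Longrightarrow> F' \<subseteq> carrier G \<Longrightarrow> finsum T (\<lambda>g. proj g t) F' = t"
proof -
  from assms show "finite F" "F \<subseteq> carrier G" by (simp_all add: supported_on_def)
  from assms show "proj g t = \<zero>\<^bsub>T\<^esub>" if "g \<in> carrier G" "g \<notin> F" for g
    using that by (simp add: supported_on_def)
  from assms have "\<forall>F'. finite F' \<longrightarrow> F \<subseteq> F' \<longrightarrow> F' \<subseteq> carrier G \<longrightarrow> t = finsum T (\<lambda>g. proj g t) F'"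
    unfolding supported_on_def by (elim conjE)
  then show "finsum T (\<lambda>g. proj g t) F' = t" if "finite F'" "F \<subseteq> F'" "F' \<subseteq> carrier G" for F'
    using that by (elim allE[of _ F']) simp
qed

lemma supported_on_exists:
  assumes "t \<in> carrier T"
  shows "\<exists>F. supported_on t F"
  using assms
proof (induction rule: homogeneous_tens_induct)
  case (tens x h u)
  note u = component_carrier[OF tens(2,3)]
  have p: "proj g (tens x u) = (if g = h then tens x u else \<zero>\<^bsub>T\<^esub>)" if "g \<in> carrier G" for g
    using that tens u by (simp add: proj_tens hcomp_homogeneous tens_zero_right)
  have "tens x u = finsum T (\<lambda>g. proj g (tens x u)) F'"
    if F': "finite F'" "{h} \<subseteq> F'" "F' \<subseteq> carrier G" for F'
  proof -
    have "finsum T (\<lambda>g. proj g (tens x u)) F' = finsum T (\<lambda>g. if h = g then tens x u else \<zero>\<^bsub>T\<^esub>) F'"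
      using F' p tens u by (intro T.M.finsum_cong') auto
    also have "\<dots> = tens x u" using T.M.finsum_singleton[of h F' "\<lambda>_. tens x u"] F' tens u by simp
    finally show ?thesis by simp
  qed
  then have "supported_on (tens x u) {h}" unfolding supported_on_def using tens p by auto
  then show ?case ..
next
  case (add t v)
  then obtain F F' where "supported_on t F" "supported_on v F'" by blast
  note F = supported_onD[OF this(1)] and F' = supported_onD[OF this(2)]
  have "t \<oplus>\<^bsub>T\<^esub> v = finsum T (\<lambda>g. proj g (t \<oplus>\<^bsub>T\<^esub> v)) E"
    if E: "finite E" "F \<union> F' \<subseteq> E" "E \<subseteq> carrier G" for E
  proof -
    have "finsum T (\<lambda>g. proj g (t \<oplus>\<^bsub>T\<^esub> v)) E = finsum T (\<lambda>g. proj g t \<oplus>\<^bsub>T\<^esub> proj g v) E"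
      using E add by (intro T.M.finsum_cong') (auto simp: proj_add subset_iff)
    also have "\<dots> = finsum T (\<lambda>g. proj g t) E \<oplus>\<^bsub>T\<^esub> finsum T (\<lambda>g. proj g v) E"
      using E add by (intro T.M.finsum_addf) auto
    also have "\<dots> = t \<oplus>\<^bsub>T\<^esub> v" using F(4)[of E] F'(4)[of E] E by simp
    finally show ?thesis by simp
  qed
  moreover have "proj g (t \<oplus>\<^bsub>T\<^esub> v) = \<zero>\<^bsub>T\<^esub>" if "g \<in> carrier G - (F \<union> F')" for g
    using F(3)[of g] F'(3)[of g] add that by (simp add: proj_add)
  ultimately have "supported_on (t \<oplus>\<^bsub>T\<^esub> v) (F \<union> F')"
    unfolding supported_on_def using F(1,2) F'(1,2) by auto
  then show ?case ..
qed

lemma finite_supp: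
  assumes "t \<in> carrier T"
  shows "finite (supp t)"
proof -
  obtain F where F: "supported_on t F" using supported_on_exists[OF assms] by blast
  then have "supp t \<subseteq> F" using supported_onD(3)[OF F] by (auto simp: supp_def)
  then show ?thesis by (rule finite_subset) (rule supported_onD(1)[OF F])
qed

lemma supp_nonempty:
  assumes "t \<in> carrier T" "t \<noteq> \<zero>\<^bsub>T\<^esub>"
  shows "supp t \<noteq> {}"
proof
  assume "supp t = {}"
  then have 0: "proj g t = \<zero>\<^bsub>T\<^esub>" if "g \<in> carrier G" for g using that by (auto simp: supp_def)
  obtain F where F: "supported_on t F" using supported_on_exists[OF assms(1)] by blast
  have "t = finsum T (\<lambda>g. proj g t) F"
    using supported_onD(4)[OF F supported_onD(1)[OF F] order_refl supported_onD(2)[OF F]] by simp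
  also have "\<dots> = finsum T (\<lambda>g. \<zero>\<^bsub>T\<^esub>) F"
    using 0 supported_onD(2)[OF F] by (intro T.M.finsum_cong') auto
  finally show False using assms(2) by simp
qed

text \<open>The component of \<open>t u\<close> in degree \<open>k\<close> is the component of
  \<open>t\<close> in degree \<open>k \<otimes> inv h\<close>, multiplied by
  \<open>u\<close>.\<close>

lemma supp_act:
  assumes t: "t \<in> carrier T" and h: "h \<in> carrier G" and u: "u \<in> A h"
  shows "supp (t \<triangleleft>\<^bsub>T\<^esub> u) \<subseteq> (\<lambda>g. g \<otimes>\<^bsub>G\<^esub> h) ` supp t"
proof
  fix k assume "k \<in> supp (t \<triangleleft>\<^bsub>T\<^esub> u)"
  then have k: "k \<in> carrier G" and p: "proj k (t \<triangleleft>\<^bsub>T\<^esub> u) \<noteq> \<zero>\<^bsub>T\<^esub>" by (auto simp: supp_def)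
  let ?g = "k \<otimes>\<^bsub>G\<^esub> inv\<^bsub>G\<^esub> h"
  have kg: "?g \<otimes>\<^bsub>G\<^esub> h = k" using k h by (simp add: G.m_assoc)
  have g: "?g \<in> carrier G" using k h by simp
  have "proj ?g t \<triangleleft>\<^bsub>T\<^esub> u \<noteq> \<zero>\<^bsub>T\<^esub>" using p unfolding proj_act[OF t g h u, unfolded kg] .
  then have "proj ?g t \<noteq> \<zero>\<^bsub>T\<^esub>" using T.l_zero[OF component_carrier[OF h u]] by metis
  then have "?g \<in> supp t" using g by (simp add: supp_def)
  then show "k \<in> (\<lambda>g. g \<otimes>\<^bsub>G\<^esub> h) ` supp t"
    using imageI[of ?g "supp t" "\<lambda>g. g \<otimes>\<^bsub>G\<^esub> h"] by (simp only: kg)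
qed

lemma card_supp_act:
  assumes "t \<in> carrier T" "h \<in> carrier G" "u \<in> A h"
  shows "card (supp (t \<triangleleft>\<^bsub>T\<^esub> u)) \<le> card (supp t)"
  using card_mono[OF _ supp_act[OF assms]] card_image_le[of "supp t" "\<lambda>g. g \<otimes>\<^bsub>G\<^esub> h"] finite_supp[OF assms(1)]
  by fastforce

section \<open>Elements of least support\<close>

lemma proj_act_finsum_eq_zero:
  assumes "finite Y" "Y \<subseteq> carrier G" "\<And>y. y \<in> Y \<Longrightarrow> u y \<in> carrier S" "t \<in> carrier T" "k \<in> carrier G"
    and "\<And>y. y \<in> Y \<Longrightarrow> proj k (t \<triangleleft>\<^bsub>T\<^esub> u y) = \<zero>\<^bsub>T\<^esub>"
  shows "proj k (t \<triangleleft>\<^bsub>T\<^esub> finsum S u Y) = \<zero>\<^bsub>T\<^esub>"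
  using assms(1,2,3,6)
proof (induction Y rule: finite_induct)
  case empty
  then show ?case using assms by simp
next
  case (insert y F)
  have "u \<in> F \<rightarrow> carrier S" using insert.prems by auto
  then show ?case using insert assms(4,5)
    by (simp add: S.finsum_insert T.rsmult_r_distr T.rsmult_closed proj_add)
qed

text \<open>If \<open>(x, y)\<close> is a unique product pair for the supports of \<open>t\<close> and \<open>s = \<Sum>\<^sub>y u\<^sub>y\<close>, then the component
  of degree \<open>x y\<close> in \<open>t r s = 0\<close> comes from \<open>t r u\<^sub>y\<close> alone, so \<open>t r u\<^sub>y\<close> has smaller support than \<open>t\<close>
  and vanishes by minimality. Then \<open>y\<close> can be dropped from the support of \<open>s\<close>.\<close>

lemma minimal_support_annihilates_components:
  assumes up: "unique_product_group G" and N: "right_submodule N S T"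
    and t: "t \<in> N" and min: "\<And>w. w \<in> N \<Longrightarrow> card (supp w) < card (supp t) \<Longrightarrow> w = \<zero>\<^bsub>T\<^esub>"
    and "finite Y" "Y \<subseteq> carrier G" "\<And>y. y \<in> Y \<Longrightarrow> u y \<in> A y"
    and "\<And>r. r \<in> A \<one>\<^bsub>G\<^esub> \<Longrightarrow> t \<triangleleft>\<^bsub>T\<^esub> r \<triangleleft>\<^bsub>T\<^esub> finsum S u Y = \<zero>\<^bsub>T\<^esub>"
  shows "\<forall>y\<in>Y. \<forall>r\<in>A \<one>\<^bsub>G\<^esub>. t \<triangleleft>\<^bsub>T\<^esub> r \<triangleleft>\<^bsub>T\<^esub> u y = \<zero>\<^bsub>T\<^esub>"
  using assms(5-8)
proof (induction Y rule: finite_psubset_induct)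
  case (psubset Y)
  interpret N: right_submodule N S T by (rule N)
  have NT: "n \<in> carrier T" if "n \<in> N" for n using T.submodule_subset[OF N] that by blast
  note tT = NT[OF t]
  have r: "r \<in> carrier S" if "r \<in> A \<one>\<^bsub>G\<^esub>" for r using that component_carrier by blast
  have u: "u y \<in> carrier S" if "y \<in> Y" for y using that psubset.prems component_carrier by blast
  show ?case
  proof (cases "Y = {} \<or> t = \<zero>\<^bsub>T\<^esub>")
    case True
    then show ?thesis using r u by auto
  next
    case False
    have X: "finite (supp t)" "supp t \<noteq> {}" "supp t \<subseteq> carrier G"
      using finite_supp[OF tT] supp_nonempty[OF tT] False by (auto simp: supp_def)
    obtain x y where x: "x \<in> supp t" and y: "y \<in> Y"
      and unique: "\<And>x' y'. x' \<in> supp t \<Longrightarrow> y' \<in> Y \<Longrightarrow> (x', y') \<noteq> (x, y) \<Longrightarrow> x \<otimes>\<^bsub>G\<^esub> y \<noteq> x' \<otimes>\<^bsub>G\<^esub> y'"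
      using unique_productE[OF up X psubset.hyps _ psubset.prems(1)] False by metis
    have xG: "x \<in> carrier G" and yG: "y \<in> carrier G" using x y X psubset.prems(1) by auto
    let ?D = "finsum S u (Y - {y})"
    have D: "?D \<in> carrier S" using u by (intro S.finsum_closed) auto
    have split: "finsum S u Y = u y \<oplus>\<^bsub>S\<^esub> ?D"
      using S.finsum_insert[of "Y - {y}" y u] u y psubset.hyps by (simp add: insert_absorb Pi_iff)
    have y0: "t \<triangleleft>\<^bsub>T\<^esub> r \<triangleleft>\<^bsub>T\<^esub> u y = \<zero>\<^bsub>T\<^esub>" if rA: "r \<in> A \<one>\<^bsub>G\<^esub>" for r
    proof -
      let ?v = "t \<triangleleft>\<^bsub>T\<^esub> r" let ?w = "?v \<triangleleft>\<^bsub>T\<^esub> u y" let ?k = "x \<otimes>\<^bsub>G\<^esub> y"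
      have v: "?v \<in> carrier T" and wN: "?w \<in> N"
        using tT r[OF rA] u[OF y] t N.rsmult_closed T.rsmult_closed by auto
      have k: "?k \<in> carrier G" using xG yG by simp
      \<comment> \<open>The pair \<open>(x, y)\<close> was chosen for \<open>supp t\<close>. As the
        support of \<open>t r\<close> lies inside it, the same pair serves for every
        \<open>r\<close>.\<close>
      have supp_v: "supp ?v \<subseteq> supp t"
        using supp_act[OF tT G.one_closed rA] X(3) by (auto simp: subset_iff image_iff)
      have "proj ?k (?v \<triangleleft>\<^bsub>T\<^esub> ?D) = \<zero>\<^bsub>T\<^esub>"
      proof (rule proj_act_finsum_eq_zero)
        fix y' assume y': "y' \<in> Y - {y}"
        then have y'G: "y' \<in> carrier G" and uy': "u y' \<in> A y'" using psubset.prems by auto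
        \<comment> \<open>A contribution in degree \<open>x y\<close> from another \<open>y'\<close>
          would give \<open>x y = x' y'\<close> with \<open>x'\<close> in \<open>supp t\<close>,
          against uniqueness.\<close>
        have "?k \<notin> (\<lambda>g. g \<otimes>\<^bsub>G\<^esub> y') ` supp ?v"
          using unique[of _ y'] y' supp_v by auto
        then have "?k \<notin> supp (?v \<triangleleft>\<^bsub>T\<^esub> u y')" using supp_act[OF v y'G uy'] by blast
        then show "proj ?k (?v \<triangleleft>\<^bsub>T\<^esub> u y') = \<zero>\<^bsub>T\<^esub>" using k by (simp add: supp_def)
      qed (use psubset u v k in auto)
      moreover have "?w \<oplus>\<^bsub>T\<^esub> ?v \<triangleleft>\<^bsub>T\<^esub> ?D = \<zero>\<^bsub>T\<^esub>"
        using psubset.prems(3)[OF rA] v u[OF y] D by (simp add: split T.rsmult_r_distr)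
      then have "proj ?k ?w \<oplus>\<^bsub>T\<^esub> proj ?k (?v \<triangleleft>\<^bsub>T\<^esub> ?D) = \<zero>\<^bsub>T\<^esub>"
        using proj_add[OF k, of ?w "?v \<triangleleft>\<^bsub>T\<^esub> ?D"] v u[OF y] D k by (simp add: T.rsmult_closed)
      ultimately have "proj ?k ?w = \<zero>\<^bsub>T\<^esub>" using k NT[OF wN] by simp
      then have "?k \<notin> supp ?w" by (simp add: supp_def)
      moreover have "?k \<in> (\<lambda>g. g \<otimes>\<^bsub>G\<^esub> y) ` supp t" using x by blast
      moreover have "supp ?w \<subseteq> (\<lambda>g. g \<otimes>\<^bsub>G\<^esub> y) ` supp t"
        using supp_act[OF v yG psubset.prems(2)[OF y]] supp_v by blast
      ultimately have "supp ?w \<subset> (\<lambda>g. g \<otimes>\<^bsub>G\<^esub> y) ` supp t" by blast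
      then have "card (supp ?w) < card (supp t)"
        using psubset_card_mono card_image_le[OF X(1)] X(1) by (meson finite_imageI order_less_le_trans)
      then show ?thesis by (rule min[OF wN])
    qed
    have "t \<triangleleft>\<^bsub>T\<^esub> r \<triangleleft>\<^bsub>T\<^esub> ?D = \<zero>\<^bsub>T\<^esub>" if rA: "r \<in> A \<one>\<^bsub>G\<^esub>" for r
      using psubset.prems(3)[OF rA] y0[OF rA] tT r[OF rA] u[OF y] D
      by (simp add: split T.rsmult_r_distr T.rsmult_closed)
    then have "\<forall>y'\<in>Y - {y}. \<forall>r\<in>A \<one>\<^bsub>G\<^esub>. t \<triangleleft>\<^bsub>T\<^esub> r \<triangleleft>\<^bsub>T\<^esub> u y' = \<zero>\<^bsub>T\<^esub>"
      using psubset.prems y by (intro psubset.IH) auto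
    then show ?thesis using y0 by blast
  qed
qed

section \<open>From primeness of the tensor product to the elementwise condition\<close>

lemma point_annihilator_base_subgroup:
  assumes "x \<in> carrier M"
  shows "additive_subgroup {r \<in> A \<one>\<^bsub>G\<^esub>. x \<triangleleft>\<^bsub>M\<^esub> r = \<zero>\<^bsub>M\<^esub>} S"
  using point_annihilator_subgroup[OF assms] by (simp add: additive_subgroup_base_ring_iff)

text \<open>The elements of the base ring that kill \<open>m\<close> form an additive subgroup, so
  the generators \<open>p b q\<close> suffice. The inner span is treated for each fixed
  \<open>q\<close>, by pulling this subgroup back along right multiplication by
  \<open>q\<close>.\<close>

lemma conj_span_annihilatesI:
  assumes m: "m \<in> carrier M" and b: "b \<in> A \<one>\<^bsub>G\<^esub>" and g: "g \<in> carrier G"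
    and prod: "\<And>p q. p \<in> A g \<Longrightarrow> q \<in> A (inv\<^bsub>G\<^esub> g) \<Longrightarrow> m \<triangleleft>\<^bsub>M\<^esub> (p \<otimes>\<^bsub>S\<^esub> b \<otimes>\<^bsub>S\<^esub> q) = \<zero>\<^bsub>M\<^esub>"
    and r: "r \<in> conj_span G S A g {b}"
  shows "m \<triangleleft>\<^bsub>M\<^esub> r = \<zero>\<^bsub>M\<^esub>"
proof -
  let ?H = "{r \<in> A \<one>\<^bsub>G\<^esub>. m \<triangleleft>\<^bsub>M\<^esub> r = \<zero>\<^bsub>M\<^esub>}"
  have H: "additive_subgroup ?H S" by (rule point_annihilator_base_subgroup[OF m])
  have "span_mult S (A g) {b} \<subseteq> {z \<in> carrier S. z \<otimes>\<^bsub>S\<^esub> q \<in> ?H}" if q: "q \<in> A (inv\<^bsub>G\<^esub> g)" for q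
  proof (rule S.span_mult_least[OF S.additive_subgroup_vimage_right[OF H]])
    show "q \<in> carrier S" using component_carrier[OF _ q] g by simp
    fix p b' assume p: "p \<in> A g" "b' \<in> {b}"
    have pb: "p \<otimes>\<^bsub>S\<^esub> b \<in> A g" using component_one_right[OF g p(1) b] .
    then have "p \<otimes>\<^bsub>S\<^esub> b \<otimes>\<^bsub>S\<^esub> q \<in> A \<one>\<^bsub>G\<^esub>"
      using component_mult_mem[OF g _ pb q] g by simp
    then show "p \<otimes>\<^bsub>S\<^esub> b' \<in> {z \<in> carrier S. z \<otimes>\<^bsub>S\<^esub> q \<in> ?H}"
      using p prod[OF p(1) q] component_carrier[OF g pb] by simp
  qed
  then have "conj_span G S A g {b} \<subseteq> ?H"
    unfolding conj_span_def by (intro S.span_mult_least[OF H]) blast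
  then show ?thesis using r by auto
qed

text \<open>Primeness is applied to the submodule generated by \<open>m \<otimes> 1\<close>, which
  is nonzero because its base part is \<open>m\<close>. To see that \<open>b\<close> kills it, let
  \<open>s\<close> be homogeneous of degree \<open>g\<close>: then
  \<open>(m \<otimes> s b) a u = m (s b a) \<otimes> u = 0\<close>, since \<open>s b a\<close> lies
  in the \<open>g\<close>-conjugate of \<open>{b}\<close>, and \<open>1\<close> is a sum of such
  products \<open>a u\<close>.\<close>

lemma prime_imp_elementwise:
  assumes "prime_right_module S T"
  shows elementwise_G_prime
  unfolding elementwise_G_prime_def
proof (intro ballI impI, rule disj_imp[THEN iffD2], rule impI)
  fix m b assume m: "m \<in> carrier M" and b: "b \<in> A \<one>\<^bsub>G\<^esub>" and m0: "m \<noteq> \<zero>\<^bsub>M\<^esub>"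
    and mb: "\<forall>g\<in>carrier G. \<forall>r\<in>conj_span G S A g {b}. m \<triangleleft>\<^bsub>M\<^esub> r = \<zero>\<^bsub>M\<^esub>"
  have bS: "b \<in> carrier S" using component_carrier[OF _ b] by simp
  let ?t = "tens m \<one>\<^bsub>S\<^esub>"
  let ?N = "(\<lambda>s. ?t \<triangleleft>\<^bsub>T\<^esub> s) ` carrier S"
  have t: "?t \<in> carrier T" using m by simp
  have N: "right_submodule ?N S T" "?t \<in> ?N" by (fact T.cyclic_submodule[OF t] T.mem_cyclic[OF t])+
  have "base_part ?t = m" using base_part_tens_base[OF m one_component] rsmult_one[OF m] by simp
  then have t0: "?t \<noteq> \<zero>\<^bsub>T\<^esub>" using m0 by auto
  have zero: "tens m (s \<otimes>\<^bsub>S\<^esub> b) = \<zero>\<^bsub>T\<^esub>" if "s \<in> carrier S" for s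
    using that
  proof (induction rule: homogeneous_induct)
    case (homogeneous g s)
    have sS: "s \<in> carrier S" using component_carrier[OF homogeneous] .
    have sb: "s \<otimes>\<^bsub>S\<^esub> b \<in> A g" using component_one_right[OF homogeneous b] .
    have "\<one>\<^bsub>S\<^esub> \<in> {r \<in> carrier S. tens m (s \<otimes>\<^bsub>S\<^esub> b) \<triangleleft>\<^bsub>T\<^esub> r = \<zero>\<^bsub>T\<^esub>}"
    proof (rule one_mem_if_products_mem[OF homogeneous(1)])
      show "additive_subgroup {r \<in> carrier S. tens m (s \<otimes>\<^bsub>S\<^esub> b) \<triangleleft>\<^bsub>T\<^esub> r = \<zero>\<^bsub>T\<^esub>} S"
        using m sS bS by (intro T.point_annihilator_subgroup) simp
      fix a u assume a: "a \<in> A (inv\<^bsub>G\<^esub> g)" and u: "u \<in> A g"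
      have aS: "a \<in> carrier S" and uS: "u \<in> carrier S"
        using component_carrier[OF _ a] component_carrier[OF _ u] homogeneous by auto
      have 1: "s \<otimes>\<^bsub>S\<^esub> b \<otimes>\<^bsub>S\<^esub> a \<in> A \<one>\<^bsub>G\<^esub>"
        using component_mult_mem[OF _ _ sb a] homogeneous(1) by simp
      have "s \<otimes>\<^bsub>S\<^esub> b \<otimes>\<^bsub>S\<^esub> a \<in> conj_span G S A g {b}"
        unfolding conj_span_def using homogeneous a by (intro S.span_mult_incl) auto
      then have "m \<triangleleft>\<^bsub>M\<^esub> (s \<otimes>\<^bsub>S\<^esub> b \<otimes>\<^bsub>S\<^esub> a) = \<zero>\<^bsub>M\<^esub>" using mb homogeneous by blast
      then have "tens m (s \<otimes>\<^bsub>S\<^esub> b \<otimes>\<^bsub>S\<^esub> a \<otimes>\<^bsub>S\<^esub> u) = \<zero>\<^bsub>T\<^esub>"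
        using tens_balanced[OF m 1 uS] uS by (simp add: tens_zero_left)
      then show "a \<otimes>\<^bsub>S\<^esub> u \<in> {r \<in> carrier S. tens m (s \<otimes>\<^bsub>S\<^esub> b) \<triangleleft>\<^bsub>T\<^esub> r = \<zero>\<^bsub>T\<^esub>}"
        using m sS bS aS uS by (simp add: tens_act S.m_assoc)
    qed
    then show ?case using m sS bS by (simp add: T.rsmult_one)
  next
    case (add s t)
    then show ?case using m bS by (simp add: S.l_distr tens_add_right)
  qed
  have "b \<in> annihilator S T ?N"
    using zero m bS by (auto simp: annihilator_def tens_act)
  moreover have "annihilator S T ?N = annihilator S T (carrier T)"
    using assms N t0 unfolding prime_right_module_def by blast
  ultimately have "b \<in> annihilator S T (carrier T)" by simp
  then have *: "v \<triangleleft>\<^bsub>T\<^esub> b = \<zero>\<^bsub>T\<^esub>" if "v \<in> carrier T" for v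
    using that by (simp add: annihilator_def)
  show "\<forall>x\<in>carrier M. x \<triangleleft>\<^bsub>M\<^esub> b = \<zero>\<^bsub>M\<^esub>"
  proof
    fix x assume x: "x \<in> carrier M"
    \<comment> \<open>The value \<open>x b\<close> is recovered from \<open>x \<otimes> b\<close> by
      \<open>base_part\<close>.\<close>
    have "tens x b = \<zero>\<^bsub>T\<^esub>" using *[of "tens x \<one>\<^bsub>S\<^esub>"] x bS by (simp add: tens_act)
    then show "x \<triangleleft>\<^bsub>M\<^esub> b = \<zero>\<^bsub>M\<^esub>" using base_part_tens_base[OF x b] by simp
  qed
qed

section \<open>From the elementwise condition to primeness of the tensor product\<close>

text \<open>For a tensor \<open>p \<otimes> w\<close> with \<open>w\<close> homogeneous, let
  \<open>c\<close> have degree inverse to that of \<open>w u\<close>, so that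
  \<open>b = w u c\<close> is in the base ring. The elementwise condition, applied to a nonzero base
  part of some \<open>t a\<close>, yields \<open>M b = 0\<close>. Hence
  \<open>(p \<otimes> w u) c d = p b \<otimes> d = 0\<close>, and \<open>1\<close> is a sum of such
  products \<open>c d\<close>.\<close>

lemma homogeneous_annihilates:
  assumes prime: elementwise_G_prime and t: "t \<in> carrier T" and t0: "t \<noteq> \<zero>\<^bsub>T\<^esub>"
    and y: "y \<in> carrier G" and u: "u \<in> A y"
    and ann: "\<And>h a. h \<in> carrier G \<Longrightarrow> a \<in> A h \<Longrightarrow> t \<triangleleft>\<^bsub>T\<^esub> a \<triangleleft>\<^bsub>T\<^esub> u = \<zero>\<^bsub>T\<^esub>"
    and v: "v \<in> carrier T"
  shows "v \<triangleleft>\<^bsub>T\<^esub> u = \<zero>\<^bsub>T\<^esub>"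
proof -
  have uS: "u \<in> carrier S" using component_carrier[OF y u] .
  obtain x where x: "x \<in> carrier G" "proj x t \<noteq> \<zero>\<^bsub>T\<^esub>"
    using supp_nonempty[OF t t0] by (auto simp: supp_def)
  \<comment> \<open>The element \<open>m\<close> for the elementwise condition: a nonzero component
    of \<open>t\<close> in degree \<open>x\<close> is shifted to degree \<open>e\<close>.\<close>
  obtain a where a: "a \<in> A (inv\<^bsub>G\<^esub> x)" and m0: "base_part (t \<triangleleft>\<^bsub>T\<^esub> a) \<noteq> \<zero>\<^bsub>M\<^esub>"
    using proj_eq_zeroI[OF t x(1)] x(2) by blast
  have aS: "a \<in> carrier S" using component_carrier[OF _ a] x(1) by simp
  have ta: "t \<triangleleft>\<^bsub>T\<^esub> a \<in> carrier T" using t aS by (rule T.rsmult_closed)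
  show ?thesis using v
  proof (induction rule: homogeneous_tens_induct)
    case (tens p h w)
    have wS: "w \<in> carrier S" using component_carrier[OF tens(2,3)] .
    have k: "h \<otimes>\<^bsub>G\<^esub> y \<in> carrier G" using tens(2) y by simp
    have wu: "w \<otimes>\<^bsub>S\<^esub> u \<in> A (h \<otimes>\<^bsub>G\<^esub> y)" using component_mult_mem[OF tens(2) y tens(3) u] .
    have pc: "p \<triangleleft>\<^bsub>M\<^esub> (w \<otimes>\<^bsub>S\<^esub> u \<otimes>\<^bsub>S\<^esub> c) = \<zero>\<^bsub>M\<^esub>"
      if c: "c \<in> A (inv\<^bsub>G\<^esub> (h \<otimes>\<^bsub>G\<^esub> y))" for c
    proof -
      let ?b = "w \<otimes>\<^bsub>S\<^esub> u \<otimes>\<^bsub>S\<^esub> c"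
      have b: "?b \<in> A \<one>\<^bsub>G\<^esub>" using component_mult_mem[OF k _ wu c] k by simp
      have cS: "c \<in> carrier S" using component_carrier[OF _ c] k by simp
      have "base_part (t \<triangleleft>\<^bsub>T\<^esub> a) \<triangleleft>\<^bsub>M\<^esub> r = \<zero>\<^bsub>M\<^esub>"
        if g: "g \<in> carrier G" and r: "r \<in> conj_span G S A g {?b}" for g r
      proof (rule conj_span_annihilatesI[OF _ b g _ r])
        fix q q' assume q: "q \<in> A g" and q': "q' \<in> A (inv\<^bsub>G\<^esub> g)"
        have qS: "q \<in> carrier S" and q'S: "q' \<in> carrier S"
          using component_carrier[OF g q] component_carrier[OF _ q'] g by auto
        have "q \<otimes>\<^bsub>S\<^esub> ?b \<in> A g" using component_one_right[OF g q b] .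
        then have e: "q \<otimes>\<^bsub>S\<^esub> ?b \<otimes>\<^bsub>S\<^esub> q' \<in> A \<one>\<^bsub>G\<^esub>"
          using component_mult_mem[OF g _ _ q'] g by fastforce
        have aqw: "a \<otimes>\<^bsub>S\<^esub> q \<otimes>\<^bsub>S\<^esub> w \<in> A (inv\<^bsub>G\<^esub> x \<otimes>\<^bsub>G\<^esub> g \<otimes>\<^bsub>G\<^esub> h)"
          using a q tens(2,3) x(1) g by (intro component_mult_mem) auto
        \<comment> \<open>Rebracketing isolates the homogeneous factor \<open>a q w\<close> in front
          of \<open>u\<close>, so that \<open>ann\<close> applies.\<close>
        have "t \<triangleleft>\<^bsub>T\<^esub> a \<triangleleft>\<^bsub>T\<^esub> (q \<otimes>\<^bsub>S\<^esub> ?b \<otimes>\<^bsub>S\<^esub> q') =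
            t \<triangleleft>\<^bsub>T\<^esub> (a \<otimes>\<^bsub>S\<^esub> q \<otimes>\<^bsub>S\<^esub> w) \<triangleleft>\<^bsub>T\<^esub> u \<triangleleft>\<^bsub>T\<^esub> (c \<otimes>\<^bsub>S\<^esub> q')"
          using t aS qS wS uS cS q'S by (simp add: T.rsmult_assoc T.rsmult_closed)
        also have "\<dots> = \<zero>\<^bsub>T\<^esub>"
          using ann[OF _ aqw] x(1) g tens(2) cS q'S by simp
        finally show "base_part (t \<triangleleft>\<^bsub>T\<^esub> a) \<triangleleft>\<^bsub>M\<^esub> (q \<otimes>\<^bsub>S\<^esub> ?b \<otimes>\<^bsub>S\<^esub> q') = \<zero>\<^bsub>M\<^esub>"
          using base_part_act[OF ta e] by simp
      qed (use ta in simp)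
      then have "base_part (t \<triangleleft>\<^bsub>T\<^esub> a) = \<zero>\<^bsub>M\<^esub> \<or> (\<forall>x\<in>carrier M. x \<triangleleft>\<^bsub>M\<^esub> ?b = \<zero>\<^bsub>M\<^esub>)"
        using prime[unfolded elementwise_G_prime_def, THEN bspec, THEN bspec, OF base_part_closed[OF ta] b]
        by blast
      then show ?thesis using m0 tens(1) by blast
    qed
    have "\<one>\<^bsub>S\<^esub> \<in> {r \<in> carrier S. tens p (w \<otimes>\<^bsub>S\<^esub> u) \<triangleleft>\<^bsub>T\<^esub> r = \<zero>\<^bsub>T\<^esub>}"
    proof (rule one_mem_if_products_mem[OF k T.point_annihilator_subgroup])
      fix c d assume c: "c \<in> A (inv\<^bsub>G\<^esub> (h \<otimes>\<^bsub>G\<^esub> y))" and d: "d \<in> A (h \<otimes>\<^bsub>G\<^esub> y)"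
      have cd: "c \<in> carrier S" "d \<in> carrier S"
        using component_carrier[OF _ c] component_carrier[OF _ d] k by auto
      have b: "w \<otimes>\<^bsub>S\<^esub> u \<otimes>\<^bsub>S\<^esub> c \<in> A \<one>\<^bsub>G\<^esub>" using component_mult_mem[OF k _ wu c] k by simp
      have "tens p (w \<otimes>\<^bsub>S\<^esub> u \<otimes>\<^bsub>S\<^esub> c \<otimes>\<^bsub>S\<^esub> d) = \<zero>\<^bsub>T\<^esub>"
        unfolding tens_balanced[OF tens(1) b cd(2), symmetric] pc[OF c] by (rule tens_zero_left[OF cd(2)])
      then show "c \<otimes>\<^bsub>S\<^esub> d \<in> {r \<in> carrier S. tens p (w \<otimes>\<^bsub>S\<^esub> u) \<triangleleft>\<^bsub>T\<^esub> r = \<zero>\<^bsub>T\<^esub>}"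
        using tens(1) wS uS cd by (simp add: tens_act S.m_assoc)
    qed (use tens(1) wS uS in simp)
    then show ?case using tens(1) wS uS by (simp add: tens_act)
  next
    case (add t v)
    then show ?case using uS by (simp add: T.rsmult_l_distr)
  qed
qed

lemma act_finsum_eq_zero:
  assumes "finite Y" "\<And>y. y \<in> Y \<Longrightarrow> u y \<in> carrier S" "v \<in> carrier T"
    and "\<And>y. y \<in> Y \<Longrightarrow> v \<triangleleft>\<^bsub>T\<^esub> u y = \<zero>\<^bsub>T\<^esub>"
  shows "v \<triangleleft>\<^bsub>T\<^esub> finsum S u Y = \<zero>\<^bsub>T\<^esub>"
  using assms(1,2,4)
proof (induction Y rule: finite_induct)
  case empty
  then show ?case using assms(3) by simp
next
  case (insert y F)
  have "u \<in> F \<rightarrow> carrier S" using insert.prems by auto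
  then show ?case using insert assms(3) by (simp add: S.finsum_insert T.rsmult_r_distr)
qed

text \<open>An element \<open>t\<close> of least support in \<open>N\<close> reduces the claim from
  \<open>s\<close> to its homogeneous components: each of them kills all homogeneous multiples of
  \<open>t\<close>, hence the whole tensor product.\<close>

lemma elementwise_imp_annihilator_eq:
  assumes up: "unique_product_group G" and prime: elementwise_G_prime
    and N: "right_submodule N S T" and N0: "N \<noteq> {\<zero>\<^bsub>T\<^esub>}" and s: "s \<in> annihilator S T N"
  shows "s \<in> annihilator S T (carrier T)"
proof -
  interpret N: right_submodule N S T by (rule N)
  have "\<zero>\<^bsub>T\<^esub> \<in> N" using N.one_closed by simp
  then obtain n where "n \<in> N \<and> n \<noteq> \<zero>\<^bsub>T\<^esub>" using N0 by blast
  then obtain t where t: "t \<in> N" "t \<noteq> \<zero>\<^bsub>T\<^esub>"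
    and min: "\<And>w. w \<in> N \<Longrightarrow> w \<noteq> \<zero>\<^bsub>T\<^esub> \<Longrightarrow> card (supp t) \<le> card (supp w)"
    using ex_has_least_nat[of "\<lambda>n. n \<in> N \<and> n \<noteq> \<zero>\<^bsub>T\<^esub>" n "\<lambda>n. card (supp n)"] by blast
  have tT: "t \<in> carrier T" using T.submodule_subset[OF N] t(1) by blast
  have sS: "s \<in> carrier S" and sN: "\<And>n. n \<in> N \<Longrightarrow> n \<triangleleft>\<^bsub>T\<^esub> s = \<zero>\<^bsub>T\<^esub>"
    using s by (auto simp: annihilator_def)
  obtain Y where Y: "finite Y" "Y \<subseteq> carrier G" "s = finsum S (\<lambda>y. hcomp y s) Y"
    using homogeneous_decomposition[OF sS] .
  have hc: "hcomp y s \<in> A y" if "y \<in> Y" for y using hcomp_closed[OF sS] Y(2) that by blast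
  have ann: "t \<triangleleft>\<^bsub>T\<^esub> a \<triangleleft>\<^bsub>T\<^esub> hcomp y s = \<zero>\<^bsub>T\<^esub>"
    if y: "y \<in> Y" and h: "h \<in> carrier G" and a: "a \<in> A h" for y h a
  proof -
    have aS: "a \<in> carrier S" using component_carrier[OF h a] .
    have ta: "t \<triangleleft>\<^bsub>T\<^esub> a \<in> N" using N.rsmult_closed[OF t(1) aS] .
    have taT: "t \<triangleleft>\<^bsub>T\<^esub> a \<in> carrier T" using T.rsmult_closed[OF tT aS] .
    have "\<forall>y\<in>Y. \<forall>r\<in>A \<one>\<^bsub>G\<^esub>. t \<triangleleft>\<^bsub>T\<^esub> a \<triangleleft>\<^bsub>T\<^esub> r \<triangleleft>\<^bsub>T\<^esub> hcomp y s = \<zero>\<^bsub>T\<^esub>"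
    proof (rule minimal_support_annihilates_components[OF up N ta _ Y(1,2) hc])
      \<comment> \<open>Acting by a homogeneous \<open>a\<close> does not enlarge the support, so a
        nonzero \<open>w\<close> with smaller support than \<open>t a\<close> would contradict the
        choice of \<open>t\<close>.\<close>
      fix w assume "w \<in> N" "card (supp w) < card (supp (t \<triangleleft>\<^bsub>T\<^esub> a))"
      then show "w = \<zero>\<^bsub>T\<^esub>" using min[of w] card_supp_act[OF tT h a] by fastforce
    next
      fix r assume "r \<in> A \<one>\<^bsub>G\<^esub>"
      then have "r \<in> carrier S" using component_carrier[OF G.one_closed] by blast
      then show "t \<triangleleft>\<^bsub>T\<^esub> a \<triangleleft>\<^bsub>T\<^esub> r \<triangleleft>\<^bsub>T\<^esub> finsum S (\<lambda>y. hcomp y s) Y = \<zero>\<^bsub>T\<^esub>"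
        using sN N.rsmult_closed[OF ta] Y(3) by simp
    qed
    \<comment> \<open>Specialise \<open>r\<close> to \<open>1\<close>.\<close>
    then show ?thesis using y one_component T.rsmult_one[OF taT] by force
  qed
  have "v \<triangleleft>\<^bsub>T\<^esub> s = \<zero>\<^bsub>T\<^esub>" if v: "v \<in> carrier T" for v
  proof -
    have "v \<triangleleft>\<^bsub>T\<^esub> finsum S (\<lambda>y. hcomp y s) Y = \<zero>\<^bsub>T\<^esub>"
    proof (rule act_finsum_eq_zero[OF Y(1) _ v])
      fix y assume y: "y \<in> Y"
      then have yG: "y \<in> carrier G" using Y(2) by blast
      show "hcomp y s \<in> carrier S" using hcomp_carrier[OF sS yG] .
      show "v \<triangleleft>\<^bsub>T\<^esub> hcomp y s = \<zero>\<^bsub>T\<^esub>"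
        by (rule homogeneous_annihilates[OF prime tT t(2) yG hc[OF y] ann[OF y] v])
    qed
    then show ?thesis using Y(3) by simp
  qed
  then show ?thesis using sS by (simp add: annihilator_def)
qed

lemma elementwise_imp_prime:
  assumes up: "unique_product_group G" and prime: elementwise_G_prime
    and M: "carrier M \<noteq> {\<zero>\<^bsub>M\<^esub>}"
  shows "prime_right_module S T"
proof -
  obtain m where m: "m \<in> carrier M" "m \<noteq> \<zero>\<^bsub>M\<^esub>" using M M.zero_closed by blast
  \<comment> \<open>The tensor product is nonzero because \<open>base_part\<close> recovers
    \<open>m\<close> from \<open>m \<otimes> 1\<close>.\<close>
  have "base_part (tens m \<one>\<^bsub>S\<^esub>) = m" using base_part_tens_base[OF m(1) one_component] rsmult_one[OF m(1)] by simp
  then have "tens m \<one>\<^bsub>S\<^esub> \<noteq> \<zero>\<^bsub>T\<^esub>" using m by auto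
  moreover have "tens m \<one>\<^bsub>S\<^esub> \<in> carrier T" using m by simp
  ultimately have nz: "carrier T \<noteq> {\<zero>\<^bsub>T\<^esub>}" by blast
  have "annihilator S T N = annihilator S T (carrier T)"
    if N: "right_submodule N S T" "N \<noteq> {\<zero>\<^bsub>T\<^esub>}" for N
  proof
    show "annihilator S T N \<subseteq> annihilator S T (carrier T)"
      using elementwise_imp_annihilator_eq[OF up prime N] by blast
    show "annihilator S T (carrier T) \<subseteq> annihilator S T N"
      using T.submodule_subset[OF N(1)] unfolding annihilator_def by blast
  qed
  then show ?thesis unfolding prime_right_module_def using nz tensor_right_module by blast
qed

end

theorem proposition3p4:
  fixes G :: "('g, 'x) monoid_scheme"
    and S R :: "('s, 'y) ring_scheme"
    and A :: "'g \<Rightarrow> 's set"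
    and M :: "('s, 'm, 'z) right_module_scheme"
  assumes "unique_product_group G"
    and "strongly_graded_ring G S A"
    and "R = S\<lparr>carrier := A \<one>\<^bsub>G\<^esub>\<rparr>"
    and "right_module R M"
    and "carrier M \<noteq> {\<zero>\<^bsub>M\<^esub>}"
  shows
    "let P1 = prime_right_module S (tensor_module R S M);
         P2 = (\<forall>m\<in>carrier M. \<forall>b\<in>carrier R.
                 (\<forall>g\<in>carrier G. \<forall>r\<in>conj_span G S A g {b}. m \<triangleleft>\<^bsub>M\<^esub> r = \<zero>\<^bsub>M\<^esub>) \<longrightarrow>
                 m = \<zero>\<^bsub>M\<^esub> \<or> (\<forall>x\<in>carrier M. x \<triangleleft>\<^bsub>M\<^esub> b = \<zero>\<^bsub>M\<^esub>));
         P3 = (\<forall>m\<in>carrier M. \<forall>B. ideal B R \<and> G_invariant G S A B \<longrightarrow>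
                 (\<forall>b\<in>B. m \<triangleleft>\<^bsub>M\<^esub> b = \<zero>\<^bsub>M\<^esub>) \<longrightarrow>
                 m = \<zero>\<^bsub>M\<^esub> \<or> (\<forall>x\<in>carrier M. \<forall>b\<in>B. x \<triangleleft>\<^bsub>M\<^esub> b = \<zero>\<^bsub>M\<^esub>));
         P4 = (\<forall>N. right_submodule N R M \<and> N \<noteq> {\<zero>\<^bsub>M\<^esub>} \<longrightarrow>
                 G_core G S A (annihilator R M N) = G_core G S A (annihilator R M (carrier M)))
     in (P1 \<longleftrightarrow> P2) \<and> (P2 \<longleftrightarrow> P3) \<and> (P3 \<longleftrightarrow> P4)"
proof -
  interpret strongly_graded_module G S A M
    using assms(2-4) by (simp add: strongly_graded_module_def)
  have cR: "carrier R = A \<one>\<^bsub>G\<^esub>" using assms(3) by simp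
  have 12: "prime_right_module S (tensor_module R S M) \<longleftrightarrow> elementwise_G_prime"
    unfolding assms(3) using prime_imp_elementwise elementwise_imp_prime[OF assms(1) _ assms(5)] by blast
  \<comment> \<open>The three implications form a cycle, which gives both equivalences.\<close>
  have 23: "elementwise_G_prime \<longleftrightarrow> idealwise_G_prime"
    and 34: "idealwise_G_prime \<longleftrightarrow> annihilator_G_prime"
    using elementwise_imp_idealwise idealwise_imp_annihilator annihilator_imp_elementwise by blast+
  show ?thesis
    unfolding Let_def cR using 12 23 34
    unfolding elementwise_G_prime_def idealwise_G_prime_def annihilator_G_prime_def
      assms(3)[symmetric] by (intro conjI)
qed

end
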